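(* Let $G=I_2(N)$ with constant multiplicity $m\in\mathbb Z_{\ge0}$. The polynomials $q_0,q_1,\ldots,q_{N-1},\bar q_1,\ldots,\bar q_{N-1},q_N$ belong to the common kernel of the operators $\mathcal L_1$ and $\mathcal L_2$, i.e. they are $m$-harmonic.
   Context: $G=I_2(N)$, $N\ge2$, is the dihedral group of order $2N$ acting on the Euclidean plane with coordinates $(x_1,x_2)$, generated by the reflections in the lines $(\alpha^j,x)=0$, $\alpha^j=(-\sin\frac{\pi j}{N},\cos\frac{\pi j}{N})$, $j=0,\ldots,N-1$; $A=\{\alpha^0,\ldots,\alpha^{N-1}\}$. All multiplicities equal $m\in\mathbb Z_{\ge0}$. Put $z=x_1+ix_2$, $\bar z=x_1-ix_2$. Polynomials have complex coefficients. The ring $S^G$ of $G$-invariant polynomials is freely generated by $\sigma_1=z\bar z$, $\sigma_2=z^N+\bar z^N$. $Q_m$ is the ring of $m$-quasiinvariants: polynomials $q(x_1,x_2)$ such that for each $\alpha\in A$ the derivatives $\partial_\alpha^{s}q$, $s=1,3,\ldots,2m-1$, vanish on the line $(\alpha,x)=0$, where $\partial_\alpha=(\alpha,\partial/\partial x)$. $\mathcal L=\Delta-2m\sum_{\alpha\in A}\frac{1}{(\alpha,x)}\partial_\alpha$. There is a (known) algebra homomorphism $\chi_m$ from $Q_m$ to a commutative algebra of differential operators with rational coefficients, $q\mapsto\mathcal L_q=\chi_m(q)$, given for homogeneous $q$ of degree $d$ by $\mathcal L_q=\frac{1}{2^dd!}(\mathrm{ad}_{\mathcal L})^d\hat q$,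 where $\mathrm{ad}_{\mathcal L}B=\mathcal LB-B\mathcal L$ and $\hat q$ is multiplication by $q$, extended linearly. Set $\mathcal L_1=\chi_m(\sigma_1)=\mathcal L$ and $\mathcal L_2=\chi_m(\sigma_2)$. A polynomial is $m$-harmonic if it lies in $\ker\mathcal L_1\cap\ker\mathcal L_2$. For $j=1,\ldots,N-1$, $$q_j=\sum_{t=0}^m a_{jt}\,\bar z^{tN}z^{(m-t)N+j},\qquad \bar q_j=\sum_{t=0}^m \bar a_{jt}\,z^{tN}\bar z^{(m-t)N+j},$$ where $(a_{j0},\ldots,a_{jm})$ is a nonzero solution (unique up to proportionality) of the linear system $\sum_{t=0}^m\big((m-2t)N+j\big)^{2s-1}a_{jt}=0$, $s=1,\ldots,m$, and $\bar a_{jt}$ is the complex conjugate of $a_{jt}$. Also $q_0=1$ and $q_N=(z^N-\bar z^N)^{2m+1}$. *)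

theory Defs
  imports "HOL-Computational_Algebra.Computational_Algebra"
begin

section \<open>Polynomials and rational functions in two variables\<close>

text \<open>
  A polynomial in \<open>x\<^sub>1, x\<^sub>2\<close> is a polynomial in \<open>x\<^sub>2\<close> whose coefficients are
  polynomials in \<open>x\<^sub>1\<close>: the coefficient of \<open>x\<^sub>1\<^sup>i x\<^sub>2\<^sup>k\<close> in \<open>p\<close> is
  \<open>coeff (coeff p k) i\<close>.
\<close>

type_synonym bipoly = "complex poly poly"
type_synonym ratfun = "bipoly fract"

definition cst :: "complex \<Rightarrow> bipoly" where "cst c = [:[:c:]:]"
definition X1 :: bipoly where "X1 = [:[:0, 1:]:]"
definition X2 :: bipoly where "X2 = [:0, 1:]"
definition Z :: bipoly where "Z = X1 + cst \<i> * X2"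
definition Zbar :: bipoly where "Zbar = X1 - cst \<i> * X2"

definition pd1 :: "bipoly \<Rightarrow> bipoly" where "pd1 = map_poly pderiv"
definition pd2 :: "bipoly \<Rightarrow> bipoly" where "pd2 = pderiv"

lemma coeff_pd1: "coeff (pd1 p) k = pderiv (coeff p k)"
  by (simp add: pd1_def coeff_map_poly)

lemma pd1_add: "pd1 (p + q) = pd1 p + pd1 q"
  by (rule poly_eqI) (simp add: coeff_pd1 pderiv_add)

lemma pd1_mult: "pd1 (p * q) = p * pd1 q + q * pd1 p"
proof (rule poly_eqI)
  fix n
  have "(\<Sum>i\<le>n. coeff (pd1 p) i * coeff q (n - i)) = coeff (q * pd1 p) n"
    by (simp add: coeff_mult mult.commute[of q])
  moreover have pderiv_sum: "pderiv (sum f A) = (\<Sum>i\<in>A. pderiv (f i))"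
    for f :: "nat \<Rightarrow> complex poly" and A
    by (induction A rule: infinite_finite_induct) (simp_all add: pderiv_add)
  moreover have "coeff (pd1 (p * q)) n =
      (\<Sum>i\<le>n. coeff p i * coeff (pd1 q) (n - i)) +
      (\<Sum>i\<le>n. coeff (pd1 p) i * coeff q (n - i))"
    by (simp add: coeff_pd1 coeff_mult pderiv_mult pderiv_sum
        sum.distrib[symmetric] mult.commute)
  ultimately show "coeff (pd1 (p * q)) n = coeff (p * pd1 q + q * pd1 p) n"
    by (simp add: coeff_mult[of p "pd1 q"])
qed

lemma pd2_mult: "pd2 (p * q) = p * pd2 q + q * pd2 p"
  by (simp add: pd2_def pderiv_mult)

lemma quotient_rule_respects:
  fixes D :: "'a \<Rightarrow> 'a :: idom"
  assumes D: "\<And>x y. D (x * y) = x * D y + y * D x"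
    and eq: "a * d = c * b"
  shows "(D a * b - a * D b) * (d * d) = (D c * d - c * D d) * (b * b)"
proof -
  have "a * D d + d * D a = c * D b + b * D c"
    using D[of a d] D[of c b] eq by simp
  hence Da: "d * D a = c * D b + b * D c - a * D d"
    by (simp add: algebra_simps)
  have "(D a * b - a * D b) * (d * d) = b * d * (d * D a) - (a * d) * d * D b"
    by (simp add: algebra_simps)
  also have "\<dots> = b * d * (c * D b + b * D c) - b * (a * d) * D d - (a * d) * d * D b"
    unfolding Da by (simp add: algebra_simps)
  also have "\<dots> = (D c * d - c * D d) * (b * b)"
    unfolding eq by (simp add: algebra_simps)
  finally show ?thesis .
qed

definition derivation :: "('a \<Rightarrow> 'a :: idom) \<Rightarrow> bool" where
  "derivation D \<longleftrightarrow> (\<forall>x y. D (x + y) = D x + D y) \<and> (\<forall>x y. D (x * y) = x * D y + y * D x)"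

text \<open>
  The extension of a derivation to the fraction field by the quotient rule; by
  \<open>fract_deriv_Fract\<close> the result does not depend on the chosen representation.
\<close>

definition fract_deriv :: "('a \<Rightarrow> 'a :: idom) \<Rightarrow> 'a fract \<Rightarrow> 'a fract" where
  "fract_deriv D f =
     (case SOME (a, b). b \<noteq> 0 \<and> f = Fraction_Field.Fract a b of
        (a, b) \<Rightarrow> Fraction_Field.Fract (D a * b - a * D b) (b * b))"

lemma fract_deriv_Fract:
  assumes D: "derivation D" and b: "b \<noteq> 0"
  shows "fract_deriv D (Fraction_Field.Fract a b) = Fraction_Field.Fract (D a * b - a * D b) (b * b)"
proof -
  let ?P = "\<lambda>(c, d). d \<noteq> 0 \<and> Fraction_Field.Fract a b = Fraction_Field.Fract c d"
  obtain c d where cd: "(SOME x. ?P x) = (c, d)" by fastforce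
  have "?P (SOME x. ?P x)"
    by (rule someI[of ?P "(a, b)"]) (use b in simp)
  hence d: "d \<noteq> 0" and "Fraction_Field.Fract a b = Fraction_Field.Fract c d"
    unfolding cd by auto
  hence eq: "a * d = c * b" using b by (simp add: eq_fract)
  have "fract_deriv D (Fraction_Field.Fract a b) =
      Fraction_Field.Fract (D c * d - c * D d) (d * d)"
    unfolding fract_deriv_def cd by simp
  also have "\<dots> = Fraction_Field.Fract (D a * b - a * D b) (b * b)"
    using b d D eq quotient_rule_respects[of D a d c b] by (simp add: eq_fract derivation_def)
  finally show ?thesis .
qed

definition d1 :: "ratfun \<Rightarrow> ratfun" where "d1 = fract_deriv pd1"
definition d2 :: "ratfun \<Rightarrow> ratfun" where "d2 = fract_deriv pd2"

lemma derivation_pd: "derivation pd1" "derivation pd2"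
  unfolding derivation_def using pd1_add pd1_mult pd2_mult by (auto simp: pd2_def pderiv_add)

lemma d1_Fract:
  "b \<noteq> 0 \<Longrightarrow> d1 (Fraction_Field.Fract a b) = Fraction_Field.Fract (pd1 a * b - a * pd1 b) (b * b)"
  by (simp add: d1_def fract_deriv_Fract derivation_pd)

lemma d2_Fract:
  "b \<noteq> 0 \<Longrightarrow> d2 (Fraction_Field.Fract a b) = Fraction_Field.Fract (pd2 a * b - a * pd2 b) (b * b)"
  by (simp add: d2_def fract_deriv_Fract derivation_pd)

lemma d1_to_fract: "d1 (to_fract p) = to_fract (pd1 p)"
  by (simp add: to_fract_def d1_Fract pd1_def map_poly_1)

lemma d2_to_fract: "d2 (to_fract p) = to_fract (pd2 p)"
  by (simp add: to_fract_def d2_Fract pd2_def)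


section \<open>The operators \<open>\<L>\<^sub>q\<close>\<close>

text \<open>
  Below, \<open>\<L>\<close> is \<open>CM_op N m\<close>, for the group \<open>I\<^sub>2(N)\<close> with all multiplicities \<open>m\<close>.
  Differential operators with rational coefficients are represented by their action on the
  field of rational functions, so that the product of operators is composition.
\<close>

definition root_vec :: "nat \<Rightarrow> nat \<Rightarrow> real \<times> real" where
  "root_vec N j = (- sin (pi * real j / real N), cos (pi * real j / real N))"

definition roots :: "nat \<Rightarrow> (real \<times> real) set" where
  "roots N = root_vec N ` {0..<N}"

definition root_form :: "real \<times> real \<Rightarrow> bipoly" where
  "root_form \<alpha> = cst (complex_of_real (fst \<alpha>)) * X1 + cst (complex_of_real (snd \<alpha>)) * X2"

definition d_root :: "real \<times> real \<Rightarrow> ratfun \<Rightarrow> ratfun" where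
  "d_root \<alpha> f = to_fract (cst (complex_of_real (fst \<alpha>))) * d1 f
             + to_fract (cst (complex_of_real (snd \<alpha>))) * d2 f"

definition CM_op :: "nat \<Rightarrow> nat \<Rightarrow> ratfun \<Rightarrow> ratfun" where
  "CM_op N m f = d1 (d1 f) + d2 (d2 f)
     - of_nat (2 * m) * (\<Sum>\<alpha>\<in>roots N. 1 / to_fract (root_form \<alpha>) * d_root \<alpha> f)"

definition ad :: "(ratfun \<Rightarrow> ratfun) \<Rightarrow> (ratfun \<Rightarrow> ratfun) \<Rightarrow> (ratfun \<Rightarrow> ratfun)" where
  "ad A B = (\<lambda>f. A (B f) - B (A f))"

definition mult_op :: "bipoly \<Rightarrow> ratfun \<Rightarrow> ratfun" where
  "mult_op q f = to_fract q * f"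

definition hom_part :: "nat \<Rightarrow> bipoly \<Rightarrow> bipoly" where
  "hom_part d q = (\<Sum>i\<le>d. monom (monom (coeff (coeff q (d - i)) i) i) (d - i))"

definition homogeneous :: "nat \<Rightarrow> bipoly \<Rightarrow> bool" where
  "homogeneous d q \<longleftrightarrow> (\<forall>i k. coeff (coeff q k) i \<noteq> 0 \<longrightarrow> i + k = d)"

text \<open>
  The formula for homogeneous \<open>q\<close> of degree \<open>d\<close>, extended linearly through the decomposition
  of \<open>q\<close> into homogeneous parts. It makes sense for every polynomial \<open>q\<close>, and is the
  homomorphism \<open>\<chi>\<^sub>m\<close> when \<open>q\<close> is \<open>m\<close>-quasiinvariant; it is only used for
  the invariants \<open>\<sigma>\<^sub>1, \<sigma>\<^sub>2\<close>. The index set of the sum is finite.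
\<close>

definition chi :: "nat \<Rightarrow> nat \<Rightarrow> bipoly \<Rightarrow> ratfun \<Rightarrow> ratfun" where
  "chi N m q f = (\<Sum>d | hom_part d q \<noteq> 0.
      1 / of_nat (2 ^ d * fact d) * ((ad (CM_op N m) ^^ d) (mult_op (hom_part d q))) f)"

lemma coeff_hom_part:
  "coeff (coeff (hom_part d q) k) i = (if i + k = d then coeff (coeff q k) i else 0)"
proof -
  have "coeff (coeff (hom_part d q) k) i =
      (\<Sum>l\<le>d. if l = i then if d - i = k then coeff (coeff q (d - i)) i else 0 else 0)"
    unfolding hom_part_def coeff_sum by (intro sum.cong) auto
  also have "\<dots> = (if i + k = d then coeff (coeff q k) i else 0)"
    by (auto simp: sum.delta)
  finally show ?thesis .
qed

lemma hom_part_homogeneous: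
  "homogeneous d q \<Longrightarrow> hom_part e q = (if e = d then q else 0)"
  by (auto simp: poly_eq_iff coeff_hom_part homogeneous_def)

lemma finite_hom_parts: "finite {d. hom_part d q \<noteq> 0}"
proof (rule finite_subset)
  let ?I = "(\<Union>k\<le>degree q. (\<lambda>i. i + k) ` {..degree (coeff q k)})"
  show "{d. hom_part d q \<noteq> 0} \<subseteq> ?I"
  proof
    fix d assume "d \<in> {d. hom_part d q \<noteq> 0}"
    then obtain k i where "i + k = d" and c: "coeff (coeff q k) i \<noteq> 0"
      by (auto simp: poly_eq_iff coeff_hom_part split: if_splits)
    moreover have "i \<le> degree (coeff q k)" using c by (rule le_degree)
    moreover have "coeff q k \<noteq> 0" using c by auto
    hence "k \<le> degree q" by (rule le_degree)
    ultimately show "d \<in> ?I" by force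
  qed
qed simp

lemma chi_homogeneous:
  assumes "homogeneous d q" "q \<noteq> 0"
  shows "chi N m q f =
    1 / of_nat (2 ^ d * fact d) * ((ad (CM_op N m) ^^ d) (mult_op q)) f"
proof -
  have "{e. hom_part e q \<noteq> 0} = {d}"
    using assms by (auto simp: hom_part_homogeneous)
  thus ?thesis
    using assms by (simp add: chi_def hom_part_homogeneous)
qed


section \<open>\<open>m\<close>-harmonic polynomials\<close>

definition sigma1 :: bipoly where "sigma1 = Z * Zbar"
definition sigma2 :: "nat \<Rightarrow> bipoly" where "sigma2 N = Z ^ N + Zbar ^ N"

definition L1 :: "nat \<Rightarrow> nat \<Rightarrow> ratfun \<Rightarrow> ratfun" where "L1 N m = chi N m sigma1"
definition L2 :: "nat \<Rightarrow> nat \<Rightarrow> ratfun \<Rightarrow> ratfun" where "L2 N m = chi N m (sigma2 N)"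

definition m_harmonic :: "nat \<Rightarrow> nat \<Rightarrow> bipoly \<Rightarrow> bool" where
  "m_harmonic N m p \<longleftrightarrow> L1 N m (to_fract p) = 0 \<and> L2 N m (to_fract p) = 0"

definition q_coeffs :: "nat \<Rightarrow> nat \<Rightarrow> nat \<Rightarrow> (nat \<Rightarrow> complex) \<Rightarrow> bool" where
  "q_coeffs N m j a \<longleftrightarrow> (\<exists>t\<le>m. a t \<noteq> 0) \<and>
     (\<forall>s\<in>{1..m}. (\<Sum>t=0..m. of_int ((int m - 2 * int t) * int N + int j) ^ (2 * s - 1) * a t) = 0)"

definition q_poly :: "nat \<Rightarrow> nat \<Rightarrow> nat \<Rightarrow> (nat \<Rightarrow> complex) \<Rightarrow> bipoly" where
  "q_poly N m j a = (\<Sum>t=0..m. cst (a t) * Zbar ^ (t * N) * Z ^ ((m - t) * N + j))"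

definition qbar_poly :: "nat \<Rightarrow> nat \<Rightarrow> nat \<Rightarrow> (nat \<Rightarrow> complex) \<Rightarrow> bipoly" where
  "qbar_poly N m j a = (\<Sum>t=0..m. cst (cnj (a t)) * Z ^ (t * N) * Zbar ^ ((m - t) * N + j))"

definition q_last :: "nat \<Rightarrow> nat \<Rightarrow> bipoly" where
  "q_last N m = (Z ^ N - Zbar ^ N) ^ (2 * m + 1)"


section \<open>The operator of \<open>\<sigma>\<^sub>1\<close> is \<open>\<L>\<close>\<close>

abbreviation rx1 :: ratfun where "rx1 \<equiv> to_fract X1"
abbreviation rx2 :: ratfun where "rx2 \<equiv> to_fract X2"

lemma fract_deriv_add:
  assumes D: "derivation D"
  shows "fract_deriv D (f + g) = fract_deriv D f + fract_deriv D g"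
proof -
  obtain a b c d where f: "f = Fraction_Field.Fract a b" "b \<noteq> 0"
    and g: "g = Fraction_Field.Fract c d" "d \<noteq> 0"
    by (metis Fract_cases)
  show ?thesis
    using f(2) g(2) D unfolding f g
    by (simp add: fract_deriv_Fract eq_fract derivation_def algebra_simps)
qed

lemma fract_deriv_mult:
  assumes D: "derivation D"
  shows "fract_deriv D (f * g) = f * fract_deriv D g + g * fract_deriv D f"
proof -
  obtain a b c d where f: "f = Fraction_Field.Fract a b" "b \<noteq> 0"
    and g: "g = Fraction_Field.Fract c d" "d \<noteq> 0"
    by (metis Fract_cases)
  show ?thesis
    using f(2) g(2) D unfolding f g
    by (simp add: fract_deriv_Fract eq_fract derivation_def algebra_simps)
qed

lemmas d_add = fract_deriv_add[OF derivation_pd(1), folded d1_def]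
  fract_deriv_add[OF derivation_pd(2), folded d2_def]
lemmas d_mult = fract_deriv_mult[OF derivation_pd(1), folded d1_def]
  fract_deriv_mult[OF derivation_pd(2), folded d2_def]

lemma d_commute: "d1 (d2 f) = d2 (d1 f)"
proof -
  obtain a b where f: "f = Fraction_Field.Fract a b" "b \<noteq> 0" by (metis Fract_cases)
  have p: "d1 (d2 (to_fract p)) = d2 (d1 (to_fract p))" for p
  proof -
    have "pd1 (pd2 p) = pd2 (pd1 p)"
      by (rule poly_eqI, rule poly_eqI)
         (simp add: coeff_pd1 pd2_def coeff_pderiv mult_ac of_nat_poly)
    thus ?thesis by (simp add: d1_to_fract d2_to_fract)
  qed
  have "f * to_fract b = to_fract a" "to_fract b \<noteq> 0"
    using f by (simp_all add: to_fract_def eq_fract Zero_fract_def)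
  moreover from p[of a] p[of b] have "to_fract b * d1 (d2 f) = to_fract b * d2 (d1 f)"
    unfolding \<open>f * to_fract b = to_fract a\<close>[symmetric]
    by (simp add: d_add d_mult algebra_simps)
  ultimately show ?thesis by simp
qed

lemma d_cst: "d1 (to_fract (cst c)) = 0" "d2 (to_fract (cst c)) = 0"
  by (simp_all add: d1_to_fract d2_to_fract pd1_def pd2_def cst_def map_poly_pCons pderiv_pCons)

lemma d_X: "d1 rx1 = 1" "d2 rx1 = 0" "d1 rx2 = 0" "d2 rx2 = 1"
  by (simp_all add: d1_to_fract d2_to_fract pd1_def pd2_def X1_def X2_def map_poly_pCons pderiv_pCons)
     (simp_all flip: one_pCons)

lemma cst_add: "cst (a + b) = cst a + cst b" and cst_mult: "cst (a * b) = cst a * cst b"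
  and cst_minus: "cst (- a) = - cst a" and cst_1: "cst 1 = 1" and cst_0: "cst 0 = 0"
  by (simp_all add: cst_def one_pCons)

lemma sigma1_eq: "sigma1 = X1 * X1 + X2 * X2"
proof -
  have "cst \<i> * cst \<i> = - 1"
    by (simp flip: cst_mult add: cst_minus cst_1)
  hence "cst \<i> * (cst \<i> * X) = - X" for X
    by (simp flip: mult.assoc)
  thus ?thesis
    by (simp add: sigma1_def Z_def Zbar_def algebra_simps)
qed

lemma homogeneous_sigma1: "homogeneous 2 sigma1" "sigma1 \<noteq> 0"
proof -
  have e: "sigma1 = [:[:0, 0, 1:], 0, 1:]"
    by (simp add: sigma1_eq X1_def X2_def)
  show "homogeneous 2 sigma1" "sigma1 \<noteq> 0"
    unfolding homogeneous_def e by (auto simp: coeff_pCons split: nat.splits if_splits)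
qed

lemma root_form_nz: "\<alpha> \<in> roots N \<Longrightarrow> root_form \<alpha> \<noteq> 0"
proof
  assume "\<alpha> \<in> roots N" "root_form \<alpha> = 0"
  then obtain t where t: "\<alpha> = (- sin t, cos t)"
    by (auto simp: roots_def root_vec_def)
  have "[:[:0, complex_of_real (fst \<alpha>):], [:complex_of_real (snd \<alpha>):]:] = 0"
    using \<open>root_form \<alpha> = 0\<close> by (simp add: root_form_def cst_def X1_def X2_def)
  hence "sin t = 0" "cos t = 0" by (auto simp: t)
  thus False using sin_zero_abs_cos_one by force
qed

lemma d_1: "d1 1 = 0" "d2 1 = 0"
  using d_cst[of 1] by (simp_all add: cst_1)

lemma d_0: "d1 0 = 0" "d2 0 = 0"
  using d_cst[of 0] by (simp_all add: cst_0)

lemma d_of_nat: "d1 (of_nat n) = 0" "d2 (of_nat n) = 0"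
  by (induction n) (simp_all add: d_0 d_1 d_add)

lemma d_uminus: "d1 (- f) = - d1 f" "d2 (- f) = - d2 f"
  using d_add(1)[of f "- f"] d_add(2)[of f "- f"] by (simp_all add: d_0 eq_neg_iff_add_eq_0 add.commute)

lemma d_diff: "d1 (f - g) = d1 f - d1 g" "d2 (f - g) = d2 f - d2 g"
  using d_add[of f "- g"] by (simp_all add: d_uminus)

lemma d_sum: "d1 (sum h A) = (\<Sum>i\<in>A. d1 (h i))" "d2 (sum h A) = (\<Sum>i\<in>A. d2 (h i))"
  by (induction A rule: infinite_finite_induct) (simp_all add: d_0 d_add)

lemma d_numeral: "d1 (numeral k) = 0" "d2 (numeral k) = 0"
  using d_of_nat[of "numeral k"] by simp_all

lemma d_inverse:
  assumes "l \<noteq> 0"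
  shows "d1 (1 / l) = - d1 l / (l * l)" "d2 (1 / l) = - d2 l / (l * l)"
proof -
  have "d1 (l * (1 / l)) = 0" "d2 (l * (1 / l)) = 0"
    using assms by (simp_all add: d_1)
  thus "d1 (1 / l) = - d1 l / (l * l)" "d2 (1 / l) = - d2 l / (l * l)"
    using assms unfolding d_mult by (simp_all add: eq_divide_eq eq_neg_iff_add_eq_0 mult_ac)
       (simp_all add: divide_simps algebra_simps)
qed

definition root_sum :: "nat \<Rightarrow> ratfun \<Rightarrow> ratfun" where
  "root_sum N f = (\<Sum>\<alpha>\<in>roots N. 1 / to_fract (root_form \<alpha>) * d_root \<alpha> f)"

lemma CM_op_alt: "CM_op N m f = d1 (d1 f) + d2 (d2 f) - of_nat (2 * m) * root_sum N f"
  by (simp add: CM_op_def root_sum_def)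

lemma root_sum_mult: "root_sum N (f * g) = f * root_sum N g + g * root_sum N f"
  by (simp add: root_sum_def d_root_def d_mult sum_distrib_left algebra_simps flip: sum.distrib)

lemma root_sum_add: "root_sum N (f + g) = root_sum N f + root_sum N g"
  by (simp add: root_sum_def d_root_def d_add algebra_simps flip: sum.distrib)

lemma d_root_form:
  "d1 (to_fract (root_form \<alpha>)) = to_fract (cst (complex_of_real (fst \<alpha>)))"
  "d2 (to_fract (root_form \<alpha>)) = to_fract (cst (complex_of_real (snd \<alpha>)))"
  by (simp_all add: root_form_def d_add d_mult d_X d_cst)

lemma CM_op_mult:
  "CM_op N m (f * g) = f * CM_op N m g + g * CM_op N m f + 2 * (d1 f * d1 g + d2 f * d2 g)"
  by (simp add: CM_op_alt root_sum_mult d_mult d_add algebra_simps)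

lemma CM_op_add: "CM_op N m (f + g) = CM_op N m f + CM_op N m g"
  by (simp add: CM_op_alt root_sum_add d_add algebra_simps)

lemma root_sum_X: "root_sum N rx1 * d1 f + root_sum N rx2 * d2 f = root_sum N f"
  by (simp add: root_sum_def d_root_def d_X sum_distrib_left mult.commute[of _ "d1 f"]
      mult.commute[of _ "d2 f"] add_divide_distrib flip: sum.distrib)

lemma x_root_sum: "rx1 * root_sum N rx1 + rx2 * root_sum N rx2 = of_nat (card (roots N))"
proof -
  have "rx1 * root_sum N rx1 + rx2 * root_sum N rx2 = (\<Sum>\<alpha>\<in>roots N. 1)"
    unfolding root_sum_def sum_distrib_left sum.distrib[symmetric]
  proof (rule sum.cong)
    fix \<alpha> assume "\<alpha> \<in> roots N"
    hence "to_fract (root_form \<alpha>) \<noteq> 0" using root_form_nz by simp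
    moreover have "to_fract (root_form \<alpha>) =
       to_fract (cst (complex_of_real (fst \<alpha>))) * rx1 + to_fract (cst (complex_of_real (snd \<alpha>))) * rx2"
      by (simp add: root_form_def)
    moreover have "rx1 * (1 / l * a) + rx2 * (1 / l * b) = 1" if "l \<noteq> 0" "l = a * rx1 + b * rx2" for l a b
      using that(1) by (simp add: divide_simps) (simp add: that(2) mult_ac)
    ultimately show "rx1 * (1 / to_fract (root_form \<alpha>) * d_root \<alpha> rx1) +
         rx2 * (1 / to_fract (root_form \<alpha>) * d_root \<alpha> rx2) = 1"
      by (simp add: d_root_def d_X)
  qed simp
  thus ?thesis by simp
qed

lemma euler_root_sum: "rx1 * d1 (root_sum N f) + rx2 * d2 (root_sum N f) =
   rx1 * root_sum N (d1 f) + rx2 * root_sum N (d2 f) - root_sum N f"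
proof -
  have "rx1 * d1 (1 / to_fract (root_form \<alpha>) * d_root \<alpha> f)
      + rx2 * d2 (1 / to_fract (root_form \<alpha>) * d_root \<alpha> f)
     = rx1 * (1 / to_fract (root_form \<alpha>) * d_root \<alpha> (d1 f))
     + rx2 * (1 / to_fract (root_form \<alpha>) * d_root \<alpha> (d2 f))
     - 1 / to_fract (root_form \<alpha>) * d_root \<alpha> f" if "\<alpha> \<in> roots N" for \<alpha>
  proof -
    define l a b where "l = to_fract (root_form \<alpha>)"
      and "a = to_fract (cst (complex_of_real (fst \<alpha>)))"
      and "b = to_fract (cst (complex_of_real (snd \<alpha>)))"
    have l: "l \<noteq> 0" using root_form_nz that by (simp add: l_def)
    have lx: "l = a * rx1 + b * rx2" by (simp add: l_def a_def b_def root_form_def)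
    have dl: "d1 l = a" "d2 l = b" by (simp_all add: l_def a_def b_def d_root_form)
    have r: "d_root \<alpha> h = a * d1 h + b * d2 h" for h
      by (simp add: d_root_def a_def b_def)
    define u where "u = d_root \<alpha> f"
    have u: "d1 u = d_root \<alpha> (d1 f)" "d2 u = d_root \<alpha> (d2 f)"
      by (simp_all add: u_def r d_add d_mult d_commute a_def b_def d_cst)
    have "rx1 * d1 (1 / l * u) + rx2 * d2 (1 / l * u) =
      rx1 * (1 / l * d1 u) + rx2 * (1 / l * d2 u) - (a * rx1 + b * rx2) / (l * l) * u"
      by (simp only: d_mult d_inverse[OF l] dl) (simp add: field_simps add_divide_distrib)
    also have "(a * rx1 + b * rx2) / (l * l) * u = 1 / l * u"
      using l by (simp flip: lx)
    finally show ?thesis by (simp add: u u_def[symmetric] l_def)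
  qed
  thus ?thesis
    unfolding root_sum_def d_sum sum_distrib_left sum.distrib[symmetric] sum_subtractf[symmetric]
    by (rule sum.cong[OF refl])
qed

lemma ad_sigma1:
  "ad (CM_op N m) (mult_op sigma1) f =
     of_nat 4 * (rx1 * d1 f + rx2 * d2 f) + (4 - of_nat (4 * m * card (roots N))) * f"
proof -
  have "CM_op N m (rx1 * rx1 + rx2 * rx2) = 4 - of_nat (4 * m) * (rx1 * root_sum N rx1 + rx2 * root_sum N rx2)"
    by (simp add: CM_op_alt root_sum_add root_sum_mult d_add d_mult d_X d_1 d_0 d_numeral algebra_simps)
  hence s: "CM_op N m (rx1 * rx1 + rx2 * rx2) = 4 - of_nat (4 * m * card (roots N))"
    by (simp add: x_root_sum algebra_simps)
  show ?thesis
    unfolding ad_def mult_op_def sigma1_eq to_fract_add to_fract_mult CM_op_mult[of N m "rx1 * rx1 + rx2 * rx2"] s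
    by (simp add: d_add d_mult d_X d_numeral algebra_simps)
qed

lemma L1_eq_CM_op: "L1 N m = CM_op N m"
proof
  fix f
  let ?K = "CM_op N m"
  define c :: ratfun where "c = 4 - of_nat (4 * m * card (roots N))"
  have dc: "d1 c = 0" "d2 c = 0"
  proof -
    have "c = of_nat 4 - of_nat (4 * m * card (roots N))" by (simp add: c_def)
    thus "d1 c = 0" "d2 c = 0" by (simp_all only: d_diff d_of_nat) simp_all
  qed
  have Kc: "?K (c * g) = c * ?K g" for g
    by (simp add: CM_op_alt root_sum_mult d_mult d_add dc d_0 algebra_simps)
       (simp add: root_sum_def d_root_def dc)
  have K4: "?K (of_nat 4 * g) = of_nat 4 * ?K g" for g
    by (simp only: CM_op_mult d_of_nat) (simp add: CM_op_alt root_sum_def d_root_def d_of_nat[of 4, simplified] d_0)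
  have K1: "?K (rx1 * d1 f) = rx1 * ?K (d1 f) + ?K rx1 * d1 f + 2 * d1 (d1 f)"
   and K2: "?K (rx2 * d2 f) = rx2 * ?K (d2 f) + ?K rx2 * d2 f + 2 * d2 (d2 f)"
    by (simp_all add: CM_op_mult d_X algebra_simps)
  have Kx: "?K rx1 * d1 f + ?K rx2 * d2 f = - of_nat (2 * m) * root_sum N f"
    unfolding root_sum_X[of N f, symmetric] CM_op_alt d_X d_1 d_0 by (simp add: algebra_simps)
  have dK: "d1 (?K f) = d1 (d1 (d1 f)) + d2 (d2 (d1 f)) - of_nat (2 * m) * d1 (root_sum N f)"
           "d2 (?K f) = d1 (d1 (d2 f)) + d2 (d2 (d2 f)) - of_nat (2 * m) * d2 (root_sum N f)"
    by (simp_all only: CM_op_alt d_diff d_add d_mult d_of_nat) (simp_all add: d_commute)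
  have E: "rx1 * d1 (?K f) + rx2 * d2 (?K f) = rx1 * ?K (d1 f) + rx2 * ?K (d2 f) + of_nat (2 * m) * root_sum N f"
  proof -
    have "rx1 * d1 (?K f) + rx2 * d2 (?K f) =
        rx1 * (d1 (d1 (d1 f)) + d2 (d2 (d1 f))) + rx2 * (d1 (d1 (d2 f)) + d2 (d2 (d2 f)))
        - of_nat (2 * m) * (rx1 * d1 (root_sum N f) + rx2 * d2 (root_sum N f))"
      unfolding dK by (simp add: algebra_simps)
    also have "\<dots> = rx1 * ?K (d1 f) + rx2 * ?K (d2 f) + of_nat (2 * m) * root_sum N f"
      unfolding euler_root_sum by (simp add: CM_op_alt algebra_simps)
    finally show ?thesis .
  qed
  have "ad ?K (ad ?K (mult_op sigma1)) f =
      ?K (of_nat 4 * (rx1 * d1 f + rx2 * d2 f) + c * f) -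
      (of_nat 4 * (rx1 * d1 (?K f) + rx2 * d2 (?K f)) + c * ?K f)"
    by (subst ad_def) (simp only: ad_sigma1 c_def)
  also have "\<dots> = of_nat 4 * (?K (rx1 * d1 f) + ?K (rx2 * d2 f) - (rx1 * d1 (?K f) + rx2 * d2 (?K f)))"
    by (simp only: CM_op_add K4 Kc) (simp add: algebra_simps)
  also have "\<dots> = of_nat 4 * (2 * d1 (d1 f) + 2 * d2 (d2 f) + (?K rx1 * d1 f + ?K rx2 * d2 f) - of_nat (2 * m) * root_sum N f)"
    by (simp only: K1 K2 E) (simp add: algebra_simps)
  also have "\<dots> = of_nat 8 * ?K f"
    unfolding Kx unfolding CM_op_alt by (simp add: algebra_simps)
  finally have *: "ad ?K (ad ?K (mult_op sigma1)) f = of_nat 8 * ?K f" .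
  have nz: "(of_nat 8 :: ratfun) \<noteq> 0"
    by (simp add: of_nat_fract Zero_fract_def eq_fract of_nat_poly del: of_nat_numeral)
  have "L1 N m f = 1 / of_nat 8 * ad ?K (ad ?K (mult_op sigma1)) f"
    unfolding L1_def chi_homogeneous[OF homogeneous_sigma1] by (simp add: eval_nat_numeral)
  also have "\<dots> = ?K f" unfolding * using nz by (simp del: of_nat_numeral)
  finally show "L1 N m f = ?K f" .
qed

end

theory Submission
  imports Defs
begin

text \<open>
  Write \<open>w\<close> for the conjugate of \<open>z\<close>. In these coordinates
  \<open>(z\<^sup>N - w\<^sup>N) \<L> = 4 (z\<^sup>N - w\<^sup>N) \<partial>\<^sub>z \<partial>\<^sub>w + 4 m N (w\<^sup>N\<^sup>-\<^sup>1 \<partial>\<^sub>z - z\<^sup>N\<^sup>-\<^sup>1 \<partial>\<^sub>w)\<close>,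
  so \<open>\<L> q\<^sub>j = 0\<close> is a two-term recursion for the coefficients of \<open>q\<^sub>j\<close>, and it follows from the
  defining linear system. If \<open>\<L> f = 0\<close>, all terms of the iterated commutator but one vanish on
  \<open>f\<close>, so \<open>\<L>\<^sub>2 f\<close> is a multiple of \<open>\<L>\<^sup>N (\<sigma>\<^sub>2 f)\<close>. Now \<open>\<L> (\<sigma>\<^sub>2 f) = 0\<close> for \<open>f = 1\<close> and \<open>f = q\<^sub>N\<close>, while
  \<open>\<L> (\<sigma>\<^sub>2 q\<^sub>j)\<close> is a multiple of \<open>\<sigma>\<^sub>1\<^sup>j\<^sup>-\<^sup>1 h\<close> with \<open>h\<close> homogeneous and \<open>\<L> h = 0\<close>. As \<open>\<L>\<close> maps
  \<open>\<sigma>\<^sub>1\<^sup>k h\<close> to a multiple of \<open>\<sigma>\<^sub>1\<^sup>k\<^sup>-\<^sup>1 h\<close> and \<open>j < N\<close>, applying \<open>\<L>\<close> another \<open>N - 1\<close> times gives \<open>0\<close>.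
\<close>


section \<open>The coefficients of \<open>q\<^sub>j\<close>\<close>

text \<open>Without the two removed indices, \<open>{..m}\<close> is a block below \<open>t\<close>
  and a block above \<open>Suc t\<close>. The shift telescopes on each: the lower block trades
  \<open>f 0\<close> for \<open>f t\<close>, the upper one \<open>f (t + 2)\<close> for
  \<open>f (Suc m)\<close>.\<close>

lemma prod_shift_gap:
  fixes f :: "nat \<Rightarrow> 'a :: comm_monoid_mult"
  assumes "t < m"
  shows "(\<Prod>r\<in>{..m} - {t, Suc t}. f (Suc r)) * (f 0 * f (t + 2))
       = (\<Prod>r\<in>{..m} - {t, Suc t}. f r) * (f t * f (Suc m))"
proof -
  have tele: "(\<Prod>i<n. g (Suc i)) * g 0 = (\<Prod>i<n. g i) * g n" for n and g :: "nat \<Rightarrow> 'a"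
    by (metis mult.commute prod.lessThan_Suc prod.lessThan_Suc_shift)
  define n where "n = m - Suc t"
  have m: "m = t + Suc n" using assms by (simp add: n_def)
  have R: "{..m} - {t, Suc t} = {..<t} \<union> (\<lambda>i. i + (t + 2)) ` {..<n}"
  proof (intro set_eqI iffI)
    fix r assume "r \<in> {..m} - {t, Suc t}"
    hence "r < t \<or> (r = (r - (t + 2)) + (t + 2) \<and> r - (t + 2) < n)" by (auto simp: m)
    thus "r \<in> {..<t} \<union> (\<lambda>i. i + (t + 2)) ` {..<n}" by blast
  qed (auto simp: m)
  have split: "(\<Prod>r\<in>{..m} - {t, Suc t}. g r) = (\<Prod>r<t. g r) * (\<Prod>i<n. g (i + (t + 2)))"
    for g :: "nat \<Rightarrow> 'a"
  proof -
    have "(\<Prod>r\<in>(\<lambda>i. i + (t + 2)) ` {..<n}. g r) = (\<Prod>i<n. g (i + (t + 2)))"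
      by (subst prod.reindex) (auto simp: inj_on_def)
    thus ?thesis unfolding R by (subst prod.union_disjoint) auto
  qed
  have "(\<Prod>r<t. f (Suc r)) * f 0 = (\<Prod>r<t. f r) * f t" by (rule tele)
  moreover have "(\<Prod>i<n. f (Suc i + (t + 2))) * f (0 + (t + 2)) =
      (\<Prod>i<n. f (i + (t + 2))) * f (n + (t + 2))"
    by (rule tele)
  ultimately have "((\<Prod>r<t. f (Suc r)) * f 0) * ((\<Prod>i<n. f (Suc i + (t + 2))) * f (0 + (t + 2))) =
      ((\<Prod>r<t. f r) * f t) * ((\<Prod>i<n. f (i + (t + 2))) * f (n + (t + 2)))"
    by (simp only:)
  thus ?thesis unfolding split by (simp add: m mult_ac add.commute[of t n])
qed

lemma sum_poly_eq_0:
  fixes x b :: "'b \<Rightarrow> 'a :: comm_ring_1"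
  assumes "\<And>s. s < m \<Longrightarrow> (\<Sum>t\<in>A. x t ^ s * b t) = 0" and "degree p < m"
  shows "(\<Sum>t\<in>A. poly p (x t) * b t) = 0"
proof -
  have "(\<Sum>t\<in>A. poly p (x t) * b t) = (\<Sum>s\<le>degree p. coeff p s * (\<Sum>t\<in>A. x t ^ s * b t))"
    unfolding poly_altdef sum_distrib_right sum_distrib_left mult.assoc by (rule sum.swap)
  also have "\<dots> = 0" using assms by (intro sum.neutral) auto
  finally show ?thesis .
qed

text \<open>
  The linear system annihilates every odd polynomial of degree below \<open>2m\<close>; testing it against
  one that vanishes at all but two of the nodes relates two consecutive coefficients.
\<close>

lemma q_coeffs_rec:
  assumes q: "q_coeffs N m j a" and j: "0 < j" "j < N" and t: "t < m"
  shows "a (Suc t) * of_nat (Suc t) * (of_nat j - of_nat (Suc t * N))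
       + a t * of_nat (m - t) * of_nat ((m - t) * N + j) = 0"
proof -
  define R where "R = {..m} - {t, Suc t}"
  define k :: "nat \<Rightarrow> complex" where "k r = of_int ((int m - 2 * int r) * int N + int j)" for r
  \<comment> \<open>The nodes satisfy \<open>k t ^ 2 - k r ^ 2 = 4 * N * e (Suc r) * c r\<close> and
    \<open>k (Suc t) ^ 2 - k r ^ 2 = 4 * N * e r * c (Suc r)\<close>, so the two surviving values of
    \<open>p\<close> differ by index shifts.\<close>
  define c :: "nat \<Rightarrow> complex" where "c r = of_int ((int m - int t - int r) * int N + int j)" for r
  define e :: "nat \<Rightarrow> complex" where "e r = of_int (int r - int t - 1)" for r
  \<comment> \<open>Odd powers of a node are the node times powers of its square, so
    \<open>p\<close> is taken in the squares.\<close>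
  define p :: "complex poly" where "p = (\<Prod>r\<in>R. [:- (k r ^ 2), 1:])"
  have card: "card R = m - 1" using t by (simp add: R_def card_Diff_subset)
  have "degree p = card R" by (simp add: p_def degree_prod_eq_sum_degree)
  hence deg: "degree p < m" using card t by simp
  have lin: "(\<Sum>r\<le>m. (k r ^ 2) ^ s * (k r * a r)) = 0" if "s < m" for s
  proof -
    have "(\<Sum>r=0..m. k r ^ (2 * Suc s - 1) * a r) = 0"
      using q that unfolding q_coeffs_def k_def by force
    thus ?thesis by (simp add: atLeast0AtMost mult_ac flip: power_mult)
  qed
  have "0 = (\<Sum>r\<le>m. poly p (k r ^ 2) * (k r * a r))"
    using sum_poly_eq_0[OF lin deg] by simp
  also have "\<dots> = (\<Sum>r\<in>{t, Suc t}. poly p (k r ^ 2) * (k r * a r))"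
  proof (rule sum.mono_neutral_right)
    show "\<forall>r\<in>{..m} - {t, Suc t}. poly p (k r ^ 2) * (k r * a r) = 0"
      by (auto simp: p_def poly_prod R_def)
  qed (use t in auto)
  finally have two: "poly p (k t ^ 2) * (k t * a t) + poly p (k (Suc t) ^ 2) * (k (Suc t) * a (Suc t)) = 0"
    by simp
  have P1: "poly p (k t ^ 2) = (4 * of_nat N) ^ card R * ((\<Prod>r\<in>R. e (Suc r)) * (\<Prod>r\<in>R. c r))"
    unfolding p_def poly_prod prod.distrib[symmetric] prod_constant[symmetric]
    by (intro prod.cong) (simp_all add: k_def c_def e_def power2_eq_square algebra_simps)
  have P2: "poly p (k (Suc t) ^ 2) = (4 * of_nat N) ^ card R * ((\<Prod>r\<in>R. e r) * (\<Prod>r\<in>R. c (Suc r)))"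
    unfolding p_def poly_prod prod.distrib[symmetric] prod_constant[symmetric]
    by (intro prod.cong) (simp_all add: k_def c_def e_def power2_eq_square algebra_simps)
  have nz: "x * int N + int j \<noteq> 0" for x
  proof
    assume "x * int N + int j = 0"
    hence "int j = int N * (- x)" by (simp add: algebra_simps)
    hence "int N dvd int j" by (rule dvdI)
    thus False using j by (auto dest: dvd_imp_le)
  qed
  have c_nz: "c r \<noteq> 0" for r unfolding c_def using nz by (simp only: of_int_eq_0_iff not_False_eq_True)
  have "e r \<noteq> 0" if "r \<in> R" for r
    using that by (auto simp: R_def e_def simp del: of_int_diff)
  hence E: "(\<Prod>r\<in>R. e r) \<noteq> 0" by (simp add: R_def)
  have C: "(\<Prod>r\<in>R. c r) \<noteq> 0" using c_nz by (simp add: R_def)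
  have kc: "k t = c t" "k (Suc t) = c (t + 2)" by (simp_all add: k_def c_def algebra_simps)
  have ev: "e 0 = - of_nat (Suc t)" "e (t + 2) = 1" "e t = - 1" "e (Suc m) = of_nat (m - t)"
    using t by (simp_all add: e_def of_nat_diff)
  have "m = t + (m - t)" using t by simp
  then obtain n where n: "m = t + n" ..
  have cv: "c 0 = of_nat ((m - t) * N + j)" "c (Suc m) = of_nat j - of_nat (Suc t * N)"
    by (simp_all add: c_def n algebra_simps)
  define A A' Ed Ed' where "A = (\<Prod>r\<in>R. c r)" "A' = (\<Prod>r\<in>R. c (Suc r))"
    "Ed = (\<Prod>r\<in>R. e r)" "Ed' = (\<Prod>r\<in>R. e (Suc r))"
  note defs = A_A'_Ed_Ed'_def
  have t1: "A' * (c 0 * c (t + 2)) = A * (c t * c (Suc m))"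
    unfolding defs R_def by (rule prod_shift_gap[OF t])
  have t2: "Ed' * of_nat (Suc t) = Ed * of_nat (m - t)"
    using prod_shift_gap[OF t, of e] unfolding ev defs R_def by (simp del: of_nat_Suc)
  have two': "Ed' * A * (c t * a t) + Ed * A' * (c (t + 2) * a (Suc t)) = 0"
  proof -
    have "(4 * of_nat N :: complex) ^ card R * (Ed' * A * (c t * a t) + Ed * A' * (c (t + 2) * a (Suc t)))
        = poly p (k t ^ 2) * (k t * a t) + poly p (k (Suc t) ^ 2) * (k (Suc t) * a (Suc t))"
      unfolding P1 P2 unfolding kc defs by (simp only: distrib_left mult_ac)
    also note two
    finally show ?thesis using j by simp
  qed
  \<comment> \<open>Multiplied by the nonzero \<open>Ed * A * c t\<close>, the claim becomes a
    multiple of \<open>two'\<close> through the telescoping identities \<open>t1\<close> and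
    \<open>t2\<close>.\<close>
  have "Ed * A * c t * (a (Suc t) * of_nat (Suc t) * c (Suc m) + a t * of_nat (m - t) * c 0)
     = of_nat (Suc t) * a (Suc t) * Ed * (A * (c t * c (Suc m))) + (Ed * of_nat (m - t)) * A * c t * a t * c 0"
    by (simp add: algebra_simps del: of_nat_Suc)
  also have "\<dots> = of_nat (Suc t) * c 0 * (Ed' * A * (c t * a t) + Ed * A' * (c (t + 2) * a (Suc t)))"
    unfolding t1[symmetric] t2[symmetric] by (simp add: algebra_simps del: of_nat_Suc)
  also have "\<dots> = 0" unfolding two' by simp
  finally show ?thesis using E C c_nz unfolding cv defs by simp
qed


section \<open>Constants and the operator \<open>\<L>\<^sub>2\<close>\<close>

abbreviation rcst :: "complex \<Rightarrow> ratfun" where "rcst c \<equiv> to_fract (cst c)"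

lemma rcst_hom:
  "rcst (a + b) = rcst a + rcst b" "rcst (a * b) = rcst a * rcst b"
  "rcst (- a) = - rcst a" "rcst (a - b) = rcst a - rcst b" "rcst 1 = 1" "rcst 0 = 0"
proof -
  show add: "rcst (a + b) = rcst a + rcst b" for a b by (simp add: cst_add)
  show minus: "rcst (- a) = - rcst a" for a by (simp add: cst_minus)
  show "rcst (a - b) = rcst a - rcst b" using add[of a "- b"] by (simp add: minus)
qed (simp_all add: cst_mult cst_1 cst_0)

lemma rcst_of_nat: "rcst (of_nat n) = of_nat n"
  by (induction n) (simp_all only: of_nat_0 of_nat_Suc rcst_hom)

lemma rcst_power: "rcst (c ^ n) = rcst c ^ n"
  by (induction n) (simp_all add: rcst_hom)

lemma rcst_sum: "rcst (sum f A) = (\<Sum>x\<in>A. rcst (f x))"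
  by (induction A rule: infinite_finite_induct) (simp_all add: rcst_hom)

lemma to_fract_sum: "to_fract (sum f A) = (\<Sum>x\<in>A. to_fract (f x))"
  by (induction A rule: infinite_finite_induct) simp_all

lemma to_fract_power: "to_fract (p ^ n) = to_fract p ^ n"
  by (induction n) simp_all

lemma CM_op_cmult: "CM_op N m (rcst c * f) = rcst c * CM_op N m f"
proof -
  have "CM_op N m (rcst c) = 0"
    by (simp add: CM_op_alt d_cst d_0 root_sum_def d_root_def)
  thus ?thesis by (simp add: CM_op_mult d_cst)
qed

lemma CM_op_0: "CM_op N m 0 = 0"
  using CM_op_cmult[of N m 0 0] by (simp add: rcst_hom)

lemma CM_op_funpow_0: "(CM_op N m ^^ n) 0 = 0"
  by (induction n) (simp_all add: CM_op_0)

text \<open>In \<open>ad L M f = L (M f) - M (L f)\<close> the last term is \<open>M 0\<close>. The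
  operators are plain functions without assumed linearity, so \<open>M 0 = 0\<close> is carried by a
  separate induction.\<close>

lemma ad_funpow_kernel:
  assumes "L 0 = 0" "B 0 = 0" "L f = 0"
  shows "(ad L ^^ n) B f = (L ^^ n) (B f)"
proof -
  have 0: "(ad L ^^ n) B 0 = 0" for n
    by (induction n) (simp_all add: ad_def assms)
  show ?thesis
    by (induction n) (simp_all add: ad_def[of L "(ad L ^^ _) B"] assms 0)
qed

lemma homogeneous_mult:
  assumes "homogeneous d p" "homogeneous e q"
  shows "homogeneous (d + e) (p * q)"
  unfolding homogeneous_def
proof (intro allI impI)
  fix i k
  assume "coeff (coeff (p * q) k) i \<noteq> 0"
  hence "(\<Sum>l\<le>k. \<Sum>n\<le>i. coeff (coeff p l) n * coeff (coeff q (k - l)) (i - n)) \<noteq> 0"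
    by (simp add: coeff_mult coeff_sum)
  then obtain l where l: "l \<le> k"
      "(\<Sum>n\<le>i. coeff (coeff p l) n * coeff (coeff q (k - l)) (i - n)) \<noteq> 0"
    by (meson atMost_iff sum.neutral)
  then obtain n where n: "n \<le> i" "coeff (coeff p l) n * coeff (coeff q (k - l)) (i - n) \<noteq> 0"
    by (meson atMost_iff sum.neutral)
  have "n + l = d" "i - n + (k - l) = e"
    using n(2) assms by (auto simp: homogeneous_def)
  thus "i + k = d + e" using l n by simp
qed

lemma homogeneous_power: "homogeneous d p \<Longrightarrow> homogeneous (n * d) (p ^ n)"
proof (induction n)
  case 0
  show ?case by (auto simp: homogeneous_def coeff_pCons split: nat.splits)
qed (simp add: homogeneous_mult)

lemma homogeneous_sigma2: "homogeneous N (sigma2 N)"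
proof -
  have "homogeneous 1 Z" "homogeneous 1 Zbar"
    by (auto simp: homogeneous_def Z_def Zbar_def X1_def X2_def cst_def coeff_pCons
        split: nat.splits)
  hence "homogeneous N (Z ^ N)" "homogeneous N (Zbar ^ N)"
    using homogeneous_power[of 1 _ N] by simp_all
  thus ?thesis
    unfolding homogeneous_def sigma2_def coeff_add by (metis add.right_neutral)
qed

lemma m_harmonicI:
  assumes "CM_op N m (to_fract p) = 0"
    and "(CM_op N m ^^ N) (to_fract (sigma2 N) * to_fract p) = 0"
  shows "m_harmonic N m p"
proof -
  have "(ad (CM_op N m) ^^ N) (mult_op (sigma2 N)) (to_fract p) = 0"
    using assms by (subst ad_funpow_kernel) (simp_all add: CM_op_0 mult_op_def)
  hence "L2 N m (to_fract p) = 0"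
  \<comment> \<open>The formula for \<open>chi\<close> on homogeneous polynomials asks for a nonzero
    one; for the zero polynomial the sum defining \<open>chi\<close> is empty.\<close>
  proof (cases "sigma2 N = 0")
    case True
    thus ?thesis by (simp add: L2_def chi_def hom_part_def)
  qed (simp add: L2_def chi_homogeneous[OF homogeneous_sigma2])
  thus ?thesis using assms by (simp add: m_harmonic_def L1_eq_CM_op)
qed


section \<open>Harmonicity in a pair of isotropic coordinates\<close>

text \<open>
  Interpreted both with \<open>u = z\<close>, \<open>v\<close> its conjugate, and with the two swapped: \<open>\<L>\<close> is
  symmetric in them, so statements about \<open>q\<^sub>j\<close> also cover its conjugate.
\<close>

locale isotropic_coords =
  fixes N m :: nat and u v :: ratfun and du dv :: "ratfun \<Rightarrow> ratfun"
  assumes N: "N \<ge> 2"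
    and deriv: "derivation du" "derivation dv"
    and const: "du (rcst c) = 0" "dv (rcst c) = 0"
    and coords: "du u = 1" "du v = 0" "dv u = 0" "dv v = 1"
    and discr: "u ^ N - v ^ N \<noteq> 0"
    and CM: "(u ^ N - v ^ N) * CM_op N m f = 4 * (u ^ N - v ^ N) * du (dv f)
      + 4 * of_nat m * of_nat N * (v ^ (N - 1) * du f - u ^ (N - 1) * dv f)"
begin

abbreviation K :: "ratfun \<Rightarrow> ratfun" where "K \<equiv> CM_op N m"

declare One_nat_def [simp del]

section \<open>Calculus of the two derivations\<close>

lemma d_rules:
  "du (f + g) = du f + du g" "dv (f + g) = dv f + dv g"
  "du (f * g) = f * du g + g * du f" "dv (f * g) = f * dv g + g * dv f"
  using deriv by (simp_all add: derivation_def)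

lemma d_zero: "du 0 = 0" "dv 0 = 0" "du 1 = 0" "dv 1 = 0"
  using const[of 0] const[of 1] by (simp_all add: rcst_hom)

lemma d_sums: "du (sum h A) = (\<Sum>x\<in>A. du (h x))" "dv (sum h A) = (\<Sum>x\<in>A. dv (h x))"
  by (induction A rule: infinite_finite_induct) (simp_all add: d_zero d_rules)

lemma nz: "u \<noteq> 0" "v \<noteq> 0"
  using coords d_zero by auto

lemma power_N: "u * u ^ (N - 1) = u ^ N" "v * v ^ (N - 1) = v ^ N"
  using N by (simp_all flip: power_Suc)

text \<open>The extra factor \<open>f\<close> stands in for the exponent \<open>n - 1\<close>, so
  \<open>n = 0\<close> is no exception.\<close>

lemma d_power:
  "du (f ^ n) * f = of_nat n * f ^ n * du f" "dv (f ^ n) * f = of_nat n * f ^ n * dv f"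
  by (induction n) (simp_all add: d_zero d_rules algebra_simps)

lemma d_minus: "du (- f) = - du f" "dv (- f) = - dv f"
  using d_rules(1)[of f "- f"] d_rules(2)[of f "- f"]
  by (simp_all add: d_zero eq_neg_iff_add_eq_0 add.commute)

lemma d_minus': "du (f - g) = du f - du g" "dv (f - g) = dv f - dv g"
  using d_rules(1)[of f "- g"] d_rules(2)[of f "- g"] by (simp_all add: d_minus)

lemma d_power_coord:
  "du (u ^ N) = of_nat N * u ^ (N - 1)" "dv (v ^ N) = of_nat N * v ^ (N - 1)"
  "du (v ^ N) = 0" "dv (u ^ N) = 0"
proof -
  have "du (u ^ N) * u = of_nat N * u ^ (N - 1) * u" "dv (v ^ N) * v = of_nat N * v ^ (N - 1) * v"
    by (simp_all add: d_power coords mult.assoc power_N mult.commute[of "_ ^ (N - 1)"])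
  thus "du (u ^ N) = of_nat N * u ^ (N - 1)" "dv (v ^ N) = of_nat N * v ^ (N - 1)"
    using nz by simp_all
  have "du (v ^ N) * v = 0" "dv (u ^ N) * u = 0" by (simp_all add: d_power coords)
  thus "du (v ^ N) = 0" "dv (u ^ N) = 0" using nz by simp_all
qed

lemma K_eqI:
  assumes "4 * (u ^ N - v ^ N) * du (dv f)
      + 4 * of_nat m * of_nat N * (v ^ (N - 1) * du f - u ^ (N - 1) * dv f) = (u ^ N - v ^ N) * g"
  shows "K f = g"
proof -
  have "(u ^ N - v ^ N) * K f = (u ^ N - v ^ N) * g"
    using assms by (simp only: CM)
  thus ?thesis using discr by simp
qed

text \<open>Multiplying by \<open>u * v\<close> turns \<open>du\<close> and \<open>dv\<close> into
  the Euler operators \<open>u du\<close> and \<open>v dv\<close>, which are diagonal on monomials;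
  since \<open>du v = 0\<close>, their composite is \<open>u v du dv\<close>.\<close>

lemma K_euler_0I:
  assumes "(u ^ N - v ^ N) * (u * du (v * dv f))
      + of_nat m * of_nat N * (v ^ N * (u * du f) - u ^ N * (v * dv f)) = 0"
  shows "K f = 0"
proof (rule K_eqI)
  have "u * v * (4 * (u ^ N - v ^ N) * du (dv f)
      + 4 * of_nat m * of_nat N * (v ^ (N - 1) * du f - u ^ (N - 1) * dv f))
    = 4 * ((u ^ N - v ^ N) * (u * du (v * dv f))
      + of_nat m * of_nat N * (v ^ N * (u * du f) - u ^ N * (v * dv f)))"
    by (simp add: d_rules coords flip: power_N) (simp add: algebra_simps)
  also have "\<dots> = 0" by (simp add: assms)
  finally show "4 * (u ^ N - v ^ N) * du (dv f)
      + 4 * of_nat m * of_nat N * (v ^ (N - 1) * du f - u ^ (N - 1) * dv f) = (u ^ N - v ^ N) * 0"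
    using nz by (simp del: mult_eq_0_iff) (simp only: mult_eq_0_iff, simp)
qed

text \<open>The first-order part of \<open>\<L>\<close> is a derivation, so the mixed terms come
  from \<open>4 du dv\<close> alone.\<close>

lemma K_mult: "K (f * g) = f * K g + g * K f + 4 * (du f * dv g + dv f * du g)"
proof (rule K_eqI)
  let ?D = "u ^ N - v ^ N"
  have "?D * (f * K g + g * K f + 4 * (du f * dv g + dv f * du g)) =
     f * (?D * K g) + g * (?D * K f) + ?D * (4 * (du f * dv g + dv f * du g))"
    by (simp only: distrib_left mult_ac)
  thus "4 * ?D * du (dv (f * g))
      + 4 * of_nat m * of_nat N * (v ^ (N - 1) * du (f * g) - u ^ (N - 1) * dv (f * g)) =
     ?D * (f * K g + g * K f + 4 * (du f * dv g + dv f * du g))"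
    unfolding CM d_rules by (simp only:) (simp add: algebra_simps)
qed

section \<open>Action on the basic invariants, on \<open>1\<close> and on \<open>q_N\<close>\<close>

lemma K_sigma1: "K (u * v) = 4 - 4 * of_nat m * of_nat N"
proof (rule K_eqI)
  have "v ^ (N - 1) * du (u * v) = v ^ N" "u ^ (N - 1) * dv (u * v) = u ^ N"
    by (simp_all add: d_rules coords mult.commute[of "_ ^ (N - 1)"] power_N)
  moreover have "du (dv (u * v)) = 1" by (simp add: d_rules coords d_zero)
  ultimately show "4 * (u ^ N - v ^ N) * du (dv (u * v))
      + 4 * of_nat m * of_nat N * (v ^ (N - 1) * du (u * v) - u ^ (N - 1) * dv (u * v))
      = (u ^ N - v ^ N) * (4 - 4 * of_nat m * of_nat N)"
    by (simp only:) (simp add: algebra_simps)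
qed

text \<open>\<open>du dv\<close> annihilates the sum, and the two first-order terms cancel.\<close>

lemma K_sigma2: "K (u ^ N + v ^ N) = 0"
proof (rule K_eqI)
  have "du (of_nat N * v ^ (N - 1)) = 0"
  proof -
    have "du (v ^ (N - 1)) * v = 0" by (simp add: d_power coords)
    thus ?thesis using nz const(1)[of "of_nat N"] by (simp add: d_rules rcst_of_nat)
  qed
  thus "4 * (u ^ N - v ^ N) * du (dv (u ^ N + v ^ N))
      + 4 * of_nat m * of_nat N * (v ^ (N - 1) * du (u ^ N + v ^ N) - u ^ (N - 1) * dv (u ^ N + v ^ N))
      = (u ^ N - v ^ N) * 0"
    by (simp add: d_rules d_power_coord)
qed

lemma K_sigma2_mult:
  assumes "K f = 0"
  shows "K ((u ^ N + v ^ N) * f) = 4 * of_nat N * (u ^ (N - 1) * dv f + v ^ (N - 1) * du f)"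
  unfolding K_mult K_sigma2 assms by (simp add: d_rules d_power_coord algebra_simps)

lemma harmonic_one: "K 1 = 0" "K (u ^ N + v ^ N) = 0"
  by (rule K_eqI, simp add: d_zero) (rule K_sigma2)

text \<open>With \<open>D = u ^ N - v ^ N\<close>, the derivatives of the power are
  \<open>c * u ^ (N - 1) * D ^ (2 * m)\<close> and \<open>- c * v ^ (N - 1) * D ^ (2 * m)\<close>.
  Differentiating again brings down a factor \<open>2 * m\<close>, which exactly offsets the
  first-order part. By the same formulas the right-hand side of \<open>K_sigma2_mult\<close>
  vanishes.\<close>

lemma harmonic_last:
  "K ((u ^ N - v ^ N) ^ (2 * m + 1)) = 0"
  "K ((u ^ N + v ^ N) * (u ^ N - v ^ N) ^ (2 * m + 1)) = 0"
proof -
  let ?D = "u ^ N - v ^ N"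
  let ?f = "?D ^ (2 * m + 1)"
  define c :: ratfun where "c = of_nat (2 * m + 1) * of_nat N"
  have pw: "?f = ?D ^ (2 * m) * ?D" by (simp add: power_add)
  have dD: "du ?D = of_nat N * u ^ (N - 1)" "dv ?D = - of_nat N * v ^ (N - 1)"
    by (simp_all add: d_minus' d_power_coord)
  have "du ?f * ?D = (c * u ^ (N - 1) * ?D ^ (2 * m)) * ?D"
    unfolding d_power unfolding pw dD c_def by (simp add: mult_ac)
  hence u1: "du ?f = c * u ^ (N - 1) * ?D ^ (2 * m)"
    by (simp only: mult_cancel_right discr simp_thms)
  have "dv ?f * ?D = (- c * v ^ (N - 1) * ?D ^ (2 * m)) * ?D"
    unfolding d_power unfolding pw dD c_def by (simp add: mult_ac)
  hence v1: "dv ?f = - c * v ^ (N - 1) * ?D ^ (2 * m)"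
    by (simp only: mult_cancel_right discr simp_thms)
  have vdv: "v * dv ?f = - c * v ^ N * ?D ^ (2 * m)"
    unfolding v1 by (simp flip: power_N add: mult_ac)
  have udu: "u * du ?f = c * u ^ N * ?D ^ (2 * m)"
    unfolding u1 by (simp flip: power_N add: mult_ac)
  have c0: "du (- c) = 0"
    using const(1)[of "- (of_nat (2 * m + 1) * of_nat N)"]
    by (simp only: rcst_hom rcst_of_nat c_def)
  have "du (v * dv ?f) = - c * v ^ N * du (?D ^ (2 * m))"
    unfolding vdv d_rules c0 by (simp add: d_power_coord)
  hence "?D * (u * du (v * dv ?f)) = - c * v ^ N * u * (du (?D ^ (2 * m)) * ?D)"
    by (simp add: mult_ac)
  also have "\<dots> = - c * v ^ N * (2 * of_nat m) * ?D ^ (2 * m) * of_nat N * (u * u ^ (N - 1))"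
    unfolding d_power dD by (simp add: mult_ac)
  finally have e: "?D * (u * du (v * dv ?f)) =
     - (of_nat m * of_nat N * (2 * c * v ^ N * u ^ N * ?D ^ (2 * m)))"
    unfolding power_N by (simp add: mult_ac)
  show K0: "K ?f = 0"
    by (rule K_euler_0I, unfold e, unfold udu vdv) (simp add: algebra_simps)
  show "K ((u ^ N + v ^ N) * ?f) = 0"
    unfolding K_sigma2_mult[OF K0] u1 v1 by (simp add: algebra_simps)
qed

text \<open>The hypothesis \<open>eu\<close> is Euler's identity: \<open>h\<close> is homogeneous of
  degree \<open>d\<close>, and each factor \<open>u * v\<close> raises the degree by 2. For
  homogeneous \<open>g\<close> the product rule then makes \<open>K (u * v * g)\<close> equal to
  \<open>u * v * K g\<close> plus a multiple of \<open>g\<close>.\<close>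

lemma K_sigma1_power:
  assumes h: "K h = 0" and eu: "u * du h + v * dv h = rcst d * h"
  shows "\<exists>c. K ((u * v) ^ Suc k * h) = rcst c * ((u * v) ^ k * h)"
proof (induction k)
  case 0
  have "K (u * v * h) = (4 - 4 * of_nat m * of_nat N) * h + 4 * (u * du h + v * dv h)"
    unfolding K_mult[of "u * v"] K_sigma1 h by (simp add: d_rules coords algebra_simps)
  also have "\<dots> = rcst (of_nat 4 - of_nat 4 * of_nat m * of_nat N + of_nat 4 * d) * h"
    unfolding eu rcst_hom rcst_of_nat by (simp add: algebra_simps)
  finally show ?case by auto
next
  case (Suc k)
  then obtain c where c: "K ((u * v) ^ Suc k * h) = rcst c * ((u * v) ^ k * h)" by blast
  have eu': "u * du ((u * v) ^ n * h) + v * dv ((u * v) ^ n * h)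
      = rcst (d + of_nat (2 * n)) * ((u * v) ^ n * h)" for n
  proof (induction n)
    case 0
    show ?case using eu by simp
  next
    case (Suc n)
    have "u * du ((u * v) ^ Suc n * h) + v * dv ((u * v) ^ Suc n * h) =
       u * v * (u * du ((u * v) ^ n * h) + v * dv ((u * v) ^ n * h)) + 2 * ((u * v) ^ Suc n * h)"
      unfolding power_Suc mult.assoc[of "u * v"] d_rules(3,4)[of "u * v"]
      by (simp add: d_rules(3,4)[of u v] coords algebra_simps)
    also have "\<dots> = rcst (d + of_nat (2 * Suc n)) * ((u * v) ^ Suc n * h)"
      unfolding Suc rcst_hom rcst_of_nat by (simp add: algebra_simps)
    finally show ?case .
  qed
  let ?g = "(u * v) ^ Suc k * h"
  have "K ((u * v) ^ Suc (Suc k) * h) = K (u * v * ?g)" by (simp add: mult.assoc)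
  also have "\<dots> = u * v * K ?g + (4 - 4 * of_nat m * of_nat N) * ?g + 4 * (u * du ?g + v * dv ?g)"
    unfolding K_mult[of "u * v"] K_sigma1
    by (simp add: d_rules(3,4)[of u v] coords algebra_simps)
  also have "\<dots> = rcst (c + of_nat 4 - of_nat 4 * of_nat m * of_nat N
      + of_nat 4 * (d + of_nat (2 * Suc k))) * ?g"
    unfolding c eu' rcst_hom rcst_of_nat by (simp add: algebra_simps)
  finally show ?case by blast
qed

text \<open>Each application of \<open>K\<close> lowers \<open>k\<close> by one and changes the
  constant, hence \<open>c\<close> is generalised; after \<open>k\<close> of them a multiple of
  \<open>h\<close> is left, which the next one kills.\<close>

lemma K_funpow_sigma1_power:
  assumes h: "K h = 0" and eu: "u * du h + v * dv h = rcst d * h" and "k < n"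
  shows "(K ^^ n) (rcst c * ((u * v) ^ k * h)) = 0"
  using \<open>k < n\<close>
proof (induction n arbitrary: k c)
  case (Suc n)
  show ?case
  proof (cases k)
    case 0
    thus ?thesis unfolding funpow_Suc_right by (simp add: CM_op_cmult h CM_op_funpow_0)
  next
    case (Suc k')
    obtain c' where "K ((u * v) ^ k * h) = rcst c' * ((u * v) ^ k' * h)"
      using K_sigma1_power[OF h eu, of k'] unfolding Suc by blast
    hence "K (rcst c * ((u * v) ^ k * h)) = rcst (c * c') * ((u * v) ^ k' * h)"
      by (simp add: CM_op_cmult rcst_hom mult.assoc)
    thus ?thesis
      using Suc.IH[of k' "c * c'"] Suc.prems Suc unfolding funpow_Suc_right by simp
  qed
qed simp

section \<open>Sums of monomials: the \<open>q_j\<close> and their companions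
  \<open>h\<close>\<close>

definition mono_term :: "nat \<Rightarrow> nat \<Rightarrow> nat \<Rightarrow> ratfun" where
  "mono_term p q t = u ^ ((m - t) * N + p) * v ^ (t * N + q)"

lemma euler_mono_term:
  "u * du (rcst c * mono_term p q t) = rcst (c * of_nat ((m - t) * N + p)) * mono_term p q t"
  "v * dv (rcst c * mono_term p q t) = rcst (c * of_nat (t * N + q)) * mono_term p q t"
proof -
  have 0: "du (v ^ n) = 0" "dv (u ^ n) = 0" for n
  proof -
    have "du (v ^ n) * v = 0" "dv (u ^ n) * u = 0" by (simp_all add: d_power coords)
    thus "du (v ^ n) = 0" "dv (u ^ n) = 0" using nz by simp_all
  qed
  have 1: "u * du (u ^ n) = of_nat n * u ^ n" "v * dv (v ^ n) = of_nat n * v ^ n" for n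
    using d_power(1)[of u n] d_power(2)[of v n] by (simp_all add: coords mult.commute)
  show "u * du (rcst c * mono_term p q t) = rcst (c * of_nat ((m - t) * N + p)) * mono_term p q t"
  proof -
    have "u * du (rcst c * mono_term p q t) =
        rcst c * v ^ (t * N + q) * (u * du (u ^ ((m - t) * N + p)))"
      by (simp add: mono_term_def d_rules const 0 mult_ac)
    thus ?thesis unfolding 1 rcst_hom rcst_of_nat mono_term_def by (simp only: mult_ac)
  qed
  show "v * dv (rcst c * mono_term p q t) = rcst (c * of_nat (t * N + q)) * mono_term p q t"
  proof -
    have "v * dv (rcst c * mono_term p q t) =
        rcst c * u ^ ((m - t) * N + p) * (v * dv (v ^ (t * N + q)))"
      by (simp add: mono_term_def d_rules const 0 mult_ac)
    thus ?thesis unfolding 1 rcst_hom rcst_of_nat mono_term_def by (simp only: mult_ac)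
  qed
qed

text \<open>This coincidence between neighbouring monomials is what makes the equations for the
  coefficients two-term.\<close>

lemma mono_term_Suc:
  assumes "t < m"
  shows "u ^ N * mono_term p q (Suc t) = v ^ N * mono_term p q t"
proof -
  obtain n where "m = t + Suc n" using assms less_iff_Suc_add by auto
  hence "m - t = Suc n" "m - Suc t = n" by simp_all
  thus ?thesis by (simp add: mono_term_def power_add mult_ac)
qed

text \<open>The \<open>u ^ N\<close> sum, moved down by one index, joins the \<open>v ^ N\<close>
  sum. The condition on \<open>x 0\<close> removes the unmatched first term, the one on
  \<open>y m\<close> closes the other end.\<close>

lemma sum_mono_term_shift:
  assumes "x 0 = 0" "\<And>t. t < m \<Longrightarrow> x (Suc t) + y t = w t" "y m = w m"
  shows "(\<Sum>t\<le>m. u ^ N * (rcst (x t) * mono_term p q t)) + (\<Sum>t\<le>m. v ^ N * (rcst (y t) * mono_term p q t))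
       = (\<Sum>t\<le>m. v ^ N * (rcst (w t) * mono_term p q t))"
proof -
  have "(\<Sum>t\<le>m. u ^ N * (rcst (x t) * mono_term p q t)) =
     (\<Sum>t<m. u ^ N * (rcst (x (Suc t)) * mono_term p q (Suc t)))"
    unfolding sum.atMost_shift by (simp add: assms rcst_hom)
  also have "\<dots> = (\<Sum>t<m. v ^ N * (rcst (x (Suc t)) * mono_term p q t))"
  proof (intro sum.cong refl)
    fix t assume "t \<in> {..<m}"
    hence "rcst (x (Suc t)) * (u ^ N * mono_term p q (Suc t)) =
        rcst (x (Suc t)) * (v ^ N * mono_term p q t)"
      by (simp only: mono_term_Suc lessThan_iff)
    thus "u ^ N * (rcst (x (Suc t)) * mono_term p q (Suc t)) =
        v ^ N * (rcst (x (Suc t)) * mono_term p q t)"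
      by (simp only: mult.left_commute)
  qed
  finally have x: "(\<Sum>t\<le>m. u ^ N * (rcst (x t) * mono_term p q t)) =
     (\<Sum>t<m. v ^ N * (rcst (x (Suc t)) * mono_term p q t))" .
  have split: "(\<Sum>t\<le>m. g t) = (\<Sum>t<m. g t) + g m" for g :: "nat \<Rightarrow> ratfun"
    by (metis lessThan_Suc_atMost sum.lessThan_Suc)
  have "(\<Sum>t<m. v ^ N * (rcst (x (Suc t)) * mono_term p q t)) + (\<Sum>t<m. v ^ N * (rcst (y t) * mono_term p q t))
      = (\<Sum>t<m. v ^ N * (rcst (w t) * mono_term p q t))"
    unfolding sum.distrib[symmetric]
    by (intro sum.cong refl) (simp add: assms(2)[symmetric] rcst_hom algebra_simps)
  thus ?thesis
    unfolding x split[of "\<lambda>t. v ^ N * (rcst (y t) * mono_term p q t)"]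
      split[of "\<lambda>t. v ^ N * (rcst (w t) * mono_term p q t)"] assms(3)
    by (simp only: add.assoc[symmetric])
qed

text \<open>In Euler form, \<open>rec\<close> cancels the interior coefficients, while the two end
  terms are multiples of \<open>p * q\<close>. The lemma serves \<open>q_j\<close> with
  \<open>(p, q) = (j, 0)\<close> and its companion \<open>h\<close> with
  \<open>(0, N - j)\<close>.\<close>

lemma harmonic_sum:
  assumes pq: "p = 0 \<or> q = 0"
    and rec: "\<And>t. t < m \<Longrightarrow>
      b (Suc t) * of_nat (Suc t * N + q) * (of_nat p - of_nat (Suc t * N))
      + b t * of_nat ((m - t) * N + p) * (of_nat ((m - t) * N) - of_nat q) = 0"
  shows "K (\<Sum>t\<le>m. rcst (b t) * mono_term p q t) = 0"
proof (rule K_euler_0I)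
  let ?f = "\<Sum>t\<le>m. rcst (b t) * mono_term p q t"
  let ?P = "\<lambda>t. of_nat ((m - t) * N + p) :: complex"
  let ?Q = "\<lambda>t. of_nat (t * N + q) :: complex"
  have udu: "u * du ?f = (\<Sum>t\<le>m. rcst (b t * ?P t) * mono_term p q t)"
    unfolding d_sums sum_distrib_left euler_mono_term ..
  have vdv: "v * dv ?f = (\<Sum>t\<le>m. rcst (b t * ?Q t) * mono_term p q t)"
    unfolding d_sums sum_distrib_left euler_mono_term ..
  have uv: "u * du (v * dv ?f) = (\<Sum>t\<le>m. rcst (b t * ?Q t * ?P t) * mono_term p q t)"
    unfolding vdv unfolding d_sums sum_distrib_left euler_mono_term ..
  define x where "x t = b t * ?Q t * (?P t - of_nat m * of_nat N)" for t
  define y where "y t = b t * ?P t * (of_nat m * of_nat N - ?Q t)" for t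
  have "(u ^ N - v ^ N) * (u * du (v * dv ?f))
      + of_nat m * of_nat N * (v ^ N * (u * du ?f) - u ^ N * (v * dv ?f))
     = (\<Sum>t\<le>m. u ^ N * (rcst (x t) * mono_term p q t)) + (\<Sum>t\<le>m. v ^ N * (rcst (y t) * mono_term p q t))"
    unfolding uv unfolding udu vdv sum_distrib_left sum_subtractf[symmetric] sum.distrib[symmetric]
      x_def y_def rcst_hom rcst_of_nat
    by (intro sum.cong refl) (simp add: algebra_simps)
  also have "\<dots> = (\<Sum>t\<le>m. v ^ N * (rcst 0 * mono_term p q t))"
  proof (rule sum_mono_term_shift)
    show "x 0 = 0" "y m = 0" using pq by (auto simp: x_def y_def)
    fix t assume t: "t < m"
    then obtain n where n: "m = t + Suc n" using less_iff_Suc_add by auto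
    show "x (Suc t) + y t = 0"
      using rec[OF t] unfolding x_def y_def n by (simp add: algebra_simps)
  qed
  finally show "(u ^ N - v ^ N) * (u * du (v * dv ?f))
      + of_nat m * of_nat N * (v ^ N * (u * du ?f) - u ^ N * (v * dv ?f)) = 0"
    by (simp add: rcst_hom)
qed

text \<open>\<open>rec\<close> times \<open>N\<close> is the recursion of
  \<open>harmonic_sum\<close>. For the second claim,
  \<open>u ^ N * (v * dv f) + v ^ N * (u * du f)\<close> equals \<open>C * (u * v) ^ j * h\<close>
  with \<open>h\<close> again harmonic; cancelling \<open>u * v\<close> leaves the power
  \<open>j - 1\<close>.\<close>

lemma harmonic_q:
  assumes j: "0 < j" "j < N"
    and rec: "\<And>t. t < m \<Longrightarrow> a (Suc t) * of_nat (Suc t) * (of_nat j - of_nat (Suc t * N))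
       + a t * of_nat (m - t) * of_nat ((m - t) * N + j) = 0"
  defines "f \<equiv> (\<Sum>t\<le>m. rcst (a t) * mono_term j 0 t)"
  shows "K f = 0" "(K ^^ N) ((u ^ N + v ^ N) * f) = 0"
proof -
  show K0: "K f = 0"
    unfolding f_def
  proof (rule harmonic_sum)
    fix t assume "t < m"
    show "a (Suc t) * of_nat (Suc t * N + 0) * (of_nat j - of_nat (Suc t * N))
      + a t * of_nat ((m - t) * N + j) * (of_nat ((m - t) * N) - of_nat 0) = 0"
      using arg_cong[OF rec[OF \<open>t < m\<close>], of "\<lambda>x. of_nat N * x"]
      by (simp only: of_nat_mult add_0_right of_nat_0 diff_zero mult_zero_left mult_zero_right
          distrib_left mult_ac)
  qed simp
  define s :: "nat \<Rightarrow> complex" where "s t = of_nat (Suc t * N) - of_nat j" for t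
  have s_nz: "s t \<noteq> 0" for t
  proof -
    have "j < Suc t * N" using j by simp
    thus ?thesis unfolding s_def by (metis eq_iff_diff_eq_0 nat_neq_iff of_nat_eq_iff)
  qed
  define P :: "nat \<Rightarrow> complex" where "P t = of_nat ((m - t) * N + j)" for t
  \<comment> \<open>Chosen so that \<open>rec\<close> reads
    \<open>a (Suc t) * Suc t = b t * (m - t)\<close>; both contributions to each coefficient of the
    \<open>v ^ N\<close> sum below are then multiples of \<open>b t\<close>.\<close>
  define b where "b t = a t * P t / s t" for t
  have bs: "b t * s t = a t * P t" for t using s_nz by (simp add: b_def)
  have rec': "a (Suc t) * of_nat (Suc t) = b t * of_nat (m - t)" if "t < m" for t
  proof -
    have "a (Suc t) * of_nat (Suc t) * (- s t) + a t * of_nat (m - t) * P t = 0"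
      using rec[OF that] by (simp only: s_def P_def minus_diff_eq)
    hence "s t * (a (Suc t) * of_nat (Suc t)) = s t * (b t * of_nat (m - t))"
      using bs[of t] by algebra
    thus ?thesis using s_nz by simp
  qed
  \<comment> \<open>The exponents come from \<open>v ^ N * mono_term j 0 t = (u * v) ^ j * mono_term
    0 (N - j) t\<close>.\<close>
  define h where "h = (\<Sum>t\<le>m. rcst (b t) * mono_term 0 (N - j) t)"
  have Kh: "K h = 0"
    unfolding h_def
  proof (rule harmonic_sum)
    fix t assume t: "t < m"
    then obtain n where n: "m = t + Suc n" using less_iff_Suc_add by auto
    have P': "P (Suc t) = of_nat ((m - t) * N) - of_nat (N - j)"
      using j by (simp add: P_def n of_nat_diff algebra_simps)
    have s': "of_nat (Suc t * N + (N - j)) = s (Suc t)"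
      using j by (simp add: s_def of_nat_diff algebra_simps)
    \<comment> \<open>As \<open>b (Suc t) * s (Suc t) = a (Suc t) * P (Suc t)\<close>, the factor
      \<open>N * P (Suc t)\<close> splits off and \<open>rec'\<close> remains.\<close>
    have "b (Suc t) * s (Suc t) * (0 - of_nat (Suc t * N)) + b t * of_nat ((m - t) * N) * P (Suc t)
       = of_nat N * P (Suc t) * (b t * of_nat (m - t) - a (Suc t) * of_nat (Suc t))"
      unfolding bs of_nat_mult by (simp add: algebra_simps del: of_nat_Suc)
    also have "\<dots> = 0" using rec'[OF t] by simp
    finally show "b (Suc t) * of_nat (Suc t * N + (N - j)) * (of_nat 0 - of_nat (Suc t * N))
      + b t * of_nat ((m - t) * N + 0) * (of_nat ((m - t) * N) - of_nat (N - j)) = 0"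
      by (simp only: s' P' of_nat_0 add_0_right)
  qed simp
  have "u * du h + v * dv h = (\<Sum>t\<le>m. rcst (b t * of_nat (m * N + (N - j))) * mono_term 0 (N - j) t)"
    unfolding h_def d_sums sum_distrib_left euler_mono_term sum.distrib[symmetric]
  proof (rule sum.cong)
    fix t assume "t \<in> {..m}"
    hence "m * N + (N - j) = (m - t) * N + 0 + (t * N + (N - j))"
      by (simp flip: add_mult_distrib)
    thus "rcst (b t * of_nat ((m - t) * N + 0)) * mono_term 0 (N - j) t +
        rcst (b t * of_nat (t * N + (N - j))) * mono_term 0 (N - j) t =
        rcst (b t * of_nat (m * N + (N - j))) * mono_term 0 (N - j) t"
      by (simp only: rcst_hom of_nat_add distrib_left distrib_right)
  qed simp
  hence eu: "u * du h + v * dv h = rcst (of_nat (m * N + (N - j))) * h"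
    by (simp only: h_def sum_distrib_left rcst_hom mult_ac)
  \<comment> \<open>\<open>C = (m - t) * N + s t\<close> for every \<open>t \<le> m\<close>; in
    particular \<open>C = s m\<close>.\<close>
  define C :: complex where "C = of_nat (Suc m * N) - of_nat j"
  have udu: "u * du f = (\<Sum>t\<le>m. rcst (a t * P t) * mono_term j 0 t)"
    unfolding f_def d_sums sum_distrib_left euler_mono_term P_def ..
  have vdv: "v * dv f = (\<Sum>t\<le>m. rcst (a t * of_nat (t * N)) * mono_term j 0 t)"
    unfolding f_def d_sums sum_distrib_left euler_mono_term by simp
  have "u ^ N * (v * dv f) + v ^ N * (u * du f) = (\<Sum>t\<le>m. v ^ N * (rcst (C * b t) * mono_term j 0 t))"
    unfolding udu vdv sum_distrib_left
  proof (rule sum_mono_term_shift)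
    fix t assume t: "t < m"
    have "a (Suc t) * of_nat (Suc t * N) + a t * P t = b t * (of_nat (m - t) * of_nat N + s t)"
      unfolding of_nat_mult mult.assoc[symmetric] distrib_left rec'[OF t] bs ..
    also have "of_nat (m - t) * of_nat N + s t = C"
      using t by (simp add: C_def s_def of_nat_diff algebra_simps)
    finally show "a (Suc t) * of_nat (Suc t * N) + a t * P t = C * b t" by (simp add: mult.commute)
  next
    show "a m * P m = C * b m" unfolding bs[symmetric] C_def s_def by (rule mult.commute)
  qed simp
  also have "\<dots> = (u * v) ^ j * (rcst C * h)"
    unfolding h_def sum_distrib_left
  proof (rule sum.cong)
    fix t
    have "v ^ N = v ^ j * v ^ (N - j)" using j by (simp flip: power_add)
    thus "v ^ N * (rcst (C * b t) * mono_term j 0 t) =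
        (u * v) ^ j * (rcst C * (rcst (b t) * mono_term 0 (N - j) t))"
      by (simp add: mono_term_def rcst_hom power_add power_mult_distrib mult_ac)
  qed simp
  finally have *: "u ^ N * (v * dv f) + v ^ N * (u * du f) = (u * v) ^ j * (rcst C * h)" .
  have "(u * v) * (u ^ (N - 1) * dv f + v ^ (N - 1) * du f) = u ^ N * (v * dv f) + v ^ N * (u * du f)"
    by (simp flip: power_N add: algebra_simps)
  also have "\<dots> = (u * v) * (rcst C * ((u * v) ^ (j - 1) * h))"
    unfolding * using j by (cases j) (simp_all add: mult_ac)
  finally have "u ^ (N - 1) * dv f + v ^ (N - 1) * du f = rcst C * ((u * v) ^ (j - 1) * h)"
    using nz by simp
  hence "K ((u ^ N + v ^ N) * f) = rcst (of_nat 4 * of_nat N * C) * ((u * v) ^ (j - 1) * h)"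
    unfolding K_sigma2_mult[OF K0] rcst_hom rcst_of_nat by (simp add: mult_ac)
  \<comment> \<open>One application of \<open>K\<close> is spent; \<open>N - 1\<close> remain for
    the exponent \<open>j - 1\<close>.\<close>
  moreover have "N = Suc (N - 1)" using N by simp
  moreover have "j - 1 < N - 1" using j by simp
  ultimately show "(K ^^ N) ((u ^ N + v ^ N) * f) = 0"
    using K_funpow_sigma1_power[OF Kh eu] by (metis comp_apply funpow_Suc_right)
qed

end


section \<open>The operator \<open>\<L>\<close> in the coordinates \<open>z\<close> and its conjugate\<close>

abbreviation rz :: ratfun where "rz \<equiv> to_fract Z"
abbreviation rw :: ratfun where "rw \<equiv> to_fract Zbar"

text \<open>The Wirtinger derivatives, acting on rational functions.\<close>

definition dz :: "ratfun \<Rightarrow> ratfun" where "dz f = rcst (1 / 2) * (d1 f - rcst \<i> * d2 f)"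
definition dw :: "ratfun \<Rightarrow> ratfun" where "dw f = rcst (1 / 2) * (d1 f + rcst \<i> * d2 f)"

lemma rz_eq: "rz = rx1 + rcst \<i> * rx2" and rw_eq: "rw = rx1 - rcst \<i> * rx2"
  by (simp_all add: Z_def Zbar_def)

lemma rcst_i: "rcst \<i> * (rcst \<i> * f) = - f"
  by (simp add: rcst_hom flip: mult.assoc rcst_hom(2))

lemma rcst_half: "rcst (1 / 2) * f + rcst (1 / 2) * f = f"
  by (simp add: rcst_hom flip: distrib_right rcst_hom(1))

lemma d1_eq: "d1 f = dz f + dw f" and d2_eq: "d2 f = rcst \<i> * (dz f - dw f)"
proof -
  show "d1 f = dz f + dw f"
    using rcst_half[of "d1 f"] by (simp add: dz_def dw_def algebra_simps)
  show "d2 f = rcst \<i> * (dz f - dw f)"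
    using rcst_half[of "d2 f"] by (simp add: dz_def dw_def algebra_simps rcst_i)
qed

lemma dz_dw_commute: "dz (dw f) = dw (dz f)"
  by (simp add: dz_def dw_def d_add d_diff d_mult d_cst d_commute algebra_simps)

lemma derivation_dz: "derivation dz" and derivation_dw: "derivation dw"
  by (simp_all add: derivation_def dz_def dw_def d_add d_mult algebra_simps)

lemma dz_dw_const: "dz (rcst c) = 0" "dw (rcst c) = 0"
  by (simp_all add: dz_def dw_def d_cst)

lemma dz_dw_coords: "dz rz = 1" "dz rw = 0" "dw rz = 0" "dw rw = 1"
  using rcst_half[of 1] rcst_i[of 1]
  by (simp_all add: dz_def dw_def rz_eq rw_eq d_add d_diff d_mult d_X d_cst distrib_left
      mult.commute[of _ "2::ratfun"])

lemma laplacian: "d1 (d1 f) + d2 (d2 f) = 4 * dz (dw f)"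
proof -
  have lin: "dz (f - g) = dz f - dz g" "dw (f - g) = dw f - dw g"
     "dz (f + g) = dz f + dz g" "dw (f + g) = dw f + dw g"
     "dz (rcst \<i> * f) = rcst \<i> * dz f" "dw (rcst \<i> * f) = rcst \<i> * dw f" for f g
    by (simp_all add: dz_def dw_def d_add d_diff d_mult d_cst algebra_simps)
  show ?thesis
    unfolding d1_eq d2_eq lin using rcst_i[of 1]
    by (simp add: algebra_simps dz_dw_commute rcst_i)
qed

lemma discriminant_nz:
  assumes "N > 0"
  shows "rz ^ N - rw ^ N \<noteq> 0"
proof
  assume "rz ^ N - rw ^ N = 0"
  hence "Z ^ N - Zbar ^ N = 0"
    by (metis eq_iff_diff_eq_0 to_fract_eq_iff to_fract_power)
  \<comment> \<open>At this complex point \<open>z\<close> is 1 and \<open>w\<close> is 0.\<close>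
  hence "poly (poly (Z ^ N - Zbar ^ N) [:- \<i> / 2:]) (1 / 2) = 0" by simp
  moreover have "poly (poly Z [:- \<i> / 2:]) (1 / 2) = 1" "poly (poly Zbar [:- \<i> / 2:]) (1 / 2) = 0"
    by (simp_all add: Z_def Zbar_def X1_def X2_def cst_def)
  ultimately show False using assms by (simp add: poly_power power_0_left)
qed

section \<open>The root sum through roots of unity\<close>

lemma sum_root_unity_powers:
  assumes "N > 0" "k \<le> N"
  shows "(\<Sum>j<N. cis (2 * pi * real j / real N) ^ k) = (if k = 0 \<or> k = N then of_nat N else 0)"
proof -
  define x where "x = cis (2 * pi * real k / real N)"
  have xN: "x ^ N = 1"
    using assms cis_multiple_2pi[of "real k"] unfolding x_def Complex.DeMoivre by simp
  \<comment> \<open>The sum is geometric with ratio \<open>x\<close>, an \<open>N\<close>-th root of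
    unity, so it vanishes unless \<open>x = 1\<close>.\<close>
  have "x = 1 \<longleftrightarrow> k = 0 \<or> k = N"
  proof
    assume x: "x = 1"
    have "inj_on (\<lambda>k. cis (2 * pi * real k / real N)) {..<N}"
      using bij_betw_roots_unity[OF assms(1)] by (rule bij_betw_imp_inj_on)
    hence "k = 0" if "k < N" using x that assms(1) unfolding x_def by (auto dest: inj_onD[of _ _ k 0])
    thus "k = 0 \<or> k = N" using assms(2) by linarith
  qed (use assms cis_multiple_2pi[of 1] in \<open>auto simp: x_def\<close>)
  moreover have "(\<Sum>j<N. cis (2 * pi * real j / real N) ^ k) = (\<Sum>j<N. x ^ j)"
    unfolding x_def Complex.DeMoivre by (simp add: mult_ac)
  ultimately show ?thesis using xN by (auto simp: geometric_sum)
qed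

text \<open>The angles lie in \<open>[0, pi]\<close>, where the cosine is injective. Hence a sum
  over the set \<open>roots N\<close> is a sum over \<open>j\<close>.\<close>

lemma inj_root_vec: "inj_on (root_vec N) {0..<N}"
proof (rule inj_onI)
  fix i j assume ij: "i \<in> {0..<N}" "j \<in> {0..<N}" "root_vec N i = root_vec N j"
  have *: "0 \<le> pi * real k / real N" "pi * real k / real N \<le> pi" if "k \<in> {0..<N}" for k
    using that mult_left_mono[of "real k" "real N" pi] by (simp_all add: divide_le_eq)
  have "cos (pi * real i / real N) = cos (pi * real j / real N)"
    using ij(3) unfolding root_vec_def by (elim Pair_inject)
  hence "pi * real i / real N = pi * real j / real N"
    by (rule cos_inj_pi[OF *[OF ij(1)] *[OF ij(2)]])
  moreover have "real N \<noteq> 0" using ij(1) by auto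
  ultimately show "i = j" by simp
qed

text \<open>With \<open>\<theta> = pi * j / N\<close>, the linear form is the imaginary part of
  \<open>cis (- \<theta>) * z\<close>, that is
  \<open>(cis (- \<theta>) * z - cis \<theta> * w) / (2 * \<i>)\<close>; pulling out
  \<open>cis (- \<theta>)\<close> leaves the root of unity
  \<open>\<omega> = cis (2 * \<theta>)\<close>.\<close>

lemma root_term:
  fixes N j f
  defines "\<alpha> \<equiv> root_vec N j" and "\<omega> \<equiv> cis (2 * pi * real j / real N)"
  shows "to_fract (root_form \<alpha>) = rcst (- \<i> / 2 * cis (- (pi * real j / real N))) * (rz - rcst \<omega> * rw)"
    and "d_root \<alpha> f = rcst (\<i> * cis (- (pi * real j / real N))) * (rcst \<omega> * dz f - dw f)"
proof -
  define \<theta> where "\<theta> = pi * real j / real N"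
  have \<omega>: "cis (- \<theta>) * \<omega> = cis \<theta>" by (simp add: \<omega>_def \<theta>_def cis_mult)
  have \<alpha>: "fst \<alpha> = - sin \<theta>" "snd \<alpha> = cos \<theta>" by (simp_all add: \<alpha>_def root_vec_def \<theta>_def)
  define k where "k = - \<i> / 2 * cis (- \<theta>)"
  have k\<omega>: "k * \<omega> = - \<i> / 2 * cis \<theta>" by (simp only: k_def mult.assoc \<omega>)
  have c1: "complex_of_real (- sin \<theta>) = k - k * \<omega>"
    unfolding k\<omega> by (simp add: k_def complex_eq_iff)
  have c2: "complex_of_real (cos \<theta>) = \<i> * (k + k * \<omega>)"
    unfolding k\<omega> by (simp add: k_def complex_eq_iff)
  show "to_fract (root_form \<alpha>) = rcst (- \<i> / 2 * cis (- (pi * real j / real N))) * (rz - rcst \<omega> * rw)"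
    unfolding root_form_def \<alpha> c1 c2 \<theta>_def[symmetric] k_def[symmetric] rz_eq rw_eq to_fract_add to_fract_mult rcst_hom
    by (simp add: algebra_simps)
  define l where "l = \<i> * cis (- \<theta>)"
  have l\<omega>: "l * \<omega> = \<i> * cis \<theta>" by (simp only: l_def mult.assoc \<omega>)
  have c3: "complex_of_real (- sin \<theta>) + \<i> * complex_of_real (cos \<theta>) = l * \<omega>"
    unfolding l\<omega> by (simp add: complex_eq_iff)
  have c4: "complex_of_real (- sin \<theta>) - \<i> * complex_of_real (cos \<theta>) = - l"
    unfolding l_def by (simp add: complex_eq_iff)
  have "d_root \<alpha> f = rcst (complex_of_real (- sin \<theta>) + \<i> * complex_of_real (cos \<theta>)) * dz f
     + rcst (complex_of_real (- sin \<theta>) - \<i> * complex_of_real (cos \<theta>)) * dw f"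
    unfolding d_root_def \<alpha> d1_eq d2_eq rcst_hom by (simp add: algebra_simps)
  thus "d_root \<alpha> f = rcst (\<i> * cis (- (pi * real j / real N))) * (rcst \<omega> * dz f - dw f)"
    unfolding c3 c4 l_def \<theta>_def[symmetric] rcst_hom by (simp add: algebra_simps)
qed

text \<open>
  With \<open>\<omega>\<close> running through the \<open>N\<close>-th roots of unity, the root sum is
  \<open>-2 \<Sum>\<^sub>\<omega> (\<omega> \<partial>\<^sub>z - \<partial>\<^sub>w) / (z - \<omega> w)\<close>, and \<open>1 / (z - \<omega> w) =
  (\<Sum>\<^sub>k z\<^sup>N\<^sup>-\<^sup>1\<^sup>-\<^sup>k (\<omega> w)\<^sup>k) / (z\<^sup>N - w\<^sup>N)\<close>.
\<close>

lemma root_sum_complex: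
  assumes N: "N > 0"
  shows "(rz ^ N - rw ^ N) * root_sum N f =
    - 2 * of_nat N * (rw ^ (N - 1) * dz f - rz ^ (N - 1) * dw f)"
proof -
  define \<omega> where "\<omega> j = cis (2 * pi * real j / real N)" for j :: nat
  have summand: "(rz ^ N - rw ^ N) * (1 / to_fract (root_form (root_vec N j)) * d_root (root_vec N j) f) =
     - 2 * (\<Sum>k<N. rz ^ (N - Suc k) * rw ^ k * (rcst (\<omega> j ^ Suc k) * dz f - rcst (\<omega> j ^ k) * dw f))"
    if j: "j < N" for j
  proof -
    let ?c = "cis (- (pi * real j / real N))"
    let ?y = "rz - rcst (\<omega> j) * rw"
    have form: "to_fract (root_form (root_vec N j)) = rcst (- \<i> / 2 * ?c) * ?y"
      and d: "d_root (root_vec N j) f = rcst (\<i> * ?c) * (rcst (\<omega> j) * dz f - dw f)"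
      unfolding \<omega>_def by (rule root_term)+
    have "root_form (root_vec N j) \<noteq> 0"
      by (rule root_form_nz) (use j in \<open>auto simp: roots_def\<close>)
    hence nz: "rcst (- \<i> / 2 * ?c) * ?y \<noteq> 0" unfolding form[symmetric] by simp
    \<comment> \<open>The phases cancel in the quotient, which leaves the factor
      \<open>- 2\<close>.\<close>
    have "rcst (\<i> * ?c) = - 2 * rcst (- \<i> / 2 * ?c)"
    proof -
      have "\<i> * ?c = (- of_nat 2) * (- \<i> / 2 * ?c)" by simp
      thus ?thesis by (simp only: rcst_hom rcst_of_nat) simp
    qed
    hence r: "1 / to_fract (root_form (root_vec N j)) * d_root (root_vec N j) f =
        - 2 * (rcst (\<omega> j) * dz f - dw f) / ?y"
      unfolding form d using nz by (simp add: divide_simps)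
    have "\<omega> j ^ N = 1"
      using N cis_multiple_2pi[of "real j"] unfolding \<omega>_def Complex.DeMoivre by (simp add: mult_ac)
    hence "rw ^ N = (rcst (\<omega> j) * rw) ^ N"
      by (simp add: power_mult_distrib rcst_hom flip: rcst_power)
    hence "rz ^ N - rw ^ N = - ((rcst (\<omega> j) * rw) ^ N - rz ^ N)" by simp
    also have "\<dots> = ?y * (\<Sum>k<N. rz ^ (N - Suc k) * (rcst (\<omega> j) * rw) ^ k)"
      unfolding power_diff_sumr2 by (simp only: mult_minus_left[symmetric] minus_diff_eq)
    finally have fac: "rz ^ N - rw ^ N = ?y * (\<Sum>k<N. rz ^ (N - Suc k) * (rcst (\<omega> j) * rw) ^ k)" .
    have "y * S * (- 2 * B / y) = - 2 * (S * B)" if "y \<noteq> 0" for y S B :: ratfun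
      using that by simp
    moreover have "?y \<noteq> 0" using nz by auto
    ultimately have "(rz ^ N - rw ^ N) * (- 2 * (rcst (\<omega> j) * dz f - dw f) / ?y) =
        - 2 * ((\<Sum>k<N. rz ^ (N - Suc k) * (rcst (\<omega> j) * rw) ^ k) * (rcst (\<omega> j) * dz f - dw f))"
      unfolding fac by blast
    also have "(\<Sum>k<N. rz ^ (N - Suc k) * (rcst (\<omega> j) * rw) ^ k) * (rcst (\<omega> j) * dz f - dw f) =
        (\<Sum>k<N. rz ^ (N - Suc k) * rw ^ k * (rcst (\<omega> j ^ Suc k) * dz f - rcst (\<omega> j ^ k) * dw f))"
      unfolding sum_distrib_right
      by (intro sum.cong refl)
        (simp add: rcst_hom rcst_power power_mult_distrib algebra_simps)
    finally show ?thesis unfolding r .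
  qed
  have S: "(\<Sum>j<N. rcst (\<omega> j ^ k)) = (if k = 0 \<or> k = N then of_nat N else 0)" if "k \<le> N" for k
    unfolding rcst_sum[symmetric] \<omega>_def sum_root_unity_powers[OF N that]
    by (simp add: rcst_of_nat rcst_hom)
  have "root_sum N f = (\<Sum>j<N. 1 / to_fract (root_form (root_vec N j)) * d_root (root_vec N j) f)"
    unfolding root_sum_def roots_def sum.reindex[OF inj_root_vec]
    by (simp add: atLeast0LessThan)
  hence "(rz ^ N - rw ^ N) * root_sum N f =
     (\<Sum>j<N. (rz ^ N - rw ^ N) * (1 / to_fract (root_form (root_vec N j)) * d_root (root_vec N j) f))"
    by (simp only: sum_distrib_left)
  also have "\<dots> = (\<Sum>j<N. - 2 * (\<Sum>k<N. rz ^ (N - Suc k) * rw ^ k *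
      (rcst (\<omega> j ^ Suc k) * dz f - rcst (\<omega> j ^ k) * dw f)))"
    by (intro sum.cong refl summand) simp
  also have "\<dots> = - 2 * (\<Sum>j<N. \<Sum>k<N. rz ^ (N - Suc k) * rw ^ k *
      (rcst (\<omega> j ^ Suc k) * dz f - rcst (\<omega> j ^ k) * dw f))"
    by (simp only: sum_distrib_left)
  also have "(\<Sum>j<N. \<Sum>k<N. rz ^ (N - Suc k) * rw ^ k * (rcst (\<omega> j ^ Suc k) * dz f - rcst (\<omega> j ^ k) * dw f)) =
     (\<Sum>k<N. \<Sum>j<N. rz ^ (N - Suc k) * rw ^ k * (rcst (\<omega> j ^ Suc k) * dz f - rcst (\<omega> j ^ k) * dw f))"
    by (rule sum.swap)
  also have "\<dots> =
     (\<Sum>k<N. rz ^ (N - Suc k) * rw ^ k * ((\<Sum>j<N. rcst (\<omega> j ^ Suc k)) * dz f - (\<Sum>j<N. rcst (\<omega> j ^ k)) * dw f))"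
    by (simp only: sum_distrib_left sum_distrib_right sum_subtractf right_diff_distrib)
  \<comment> \<open>For \<open>k < N\<close> the power sum with exponent \<open>Suc k\<close>
    survives only at \<open>Suc k = N\<close>, the one with exponent \<open>k\<close> only at
    \<open>k = 0\<close>.\<close>
  also have "\<dots> = (\<Sum>k<N. (if k = N - 1 then of_nat N * rw ^ k * dz f else 0)
      - (if k = 0 then of_nat N * rz ^ (N - 1) * dw f else 0))"
  proof (intro sum.cong refl)
    fix k assume k: "k \<in> {..<N}"
    hence "k \<le> N" "Suc k \<le> N" by auto
    note S = S[OF this(1)] S[OF this(2)]
    show "rz ^ (N - Suc k) * rw ^ k * ((\<Sum>j<N. rcst (\<omega> j ^ Suc k)) * dz f - (\<Sum>j<N. rcst (\<omega> j ^ k)) * dw f) =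
       (if k = N - 1 then of_nat N * rw ^ k * dz f else 0)
      - (if k = 0 then of_nat N * rz ^ (N - 1) * dw f else 0)"
      unfolding S using N k by (auto simp: algebra_simps)
  qed
  also have "\<dots> = of_nat N * (rw ^ (N - 1) * dz f - rz ^ (N - 1) * dw f)"
    using N by (simp add: sum_subtractf algebra_simps)
  finally show ?thesis by (simp only: mult.assoc)
qed

lemma CM_op_complex:
  assumes "N > 0"
  shows "(rz ^ N - rw ^ N) * CM_op N m f = 4 * (rz ^ N - rw ^ N) * dz (dw f)
      + 4 * of_nat m * of_nat N * (rw ^ (N - 1) * dz f - rz ^ (N - 1) * dw f)"
proof -
  have "(rz ^ N - rw ^ N) * CM_op N m f = 4 * (rz ^ N - rw ^ N) * dz (dw f)
      - of_nat (2 * m) * ((rz ^ N - rw ^ N) * root_sum N f)"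
    unfolding CM_op_alt laplacian by (simp add: algebra_simps)
  thus ?thesis unfolding root_sum_complex[OF assms] by (simp add: algebra_simps)
qed

lemma isotropic_coords_complex:
  assumes "N \<ge> 2"
  shows "isotropic_coords N m rz rw dz dw" "isotropic_coords N m rw rz dw dz"
proof -
  have N: "N > 0" using assms by simp
  show "isotropic_coords N m rz rw dz dw"
    by unfold_locales
      (use assms CM_op_complex[OF N] discriminant_nz[OF N] derivation_dz derivation_dw
        dz_dw_const dz_dw_coords in auto)
  \<comment> \<open>Exchanging the variables reverses the sign of both the discriminant and the
    first-order bracket, so the identity for the first pair is negated.\<close>
  have "(rw ^ N - rz ^ N) * CM_op N m f = 4 * (rw ^ N - rz ^ N) * dw (dz f)
      + 4 * of_nat m * of_nat N * (rz ^ (N - 1) * dw f - rw ^ (N - 1) * dz f)" for f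
    using arg_cong[OF CM_op_complex[OF N, of m f], of uminus]
    by (simp add: algebra_simps dz_dw_commute)
  thus "isotropic_coords N m rw rz dw dz"
    by unfold_locales
      (use assms discriminant_nz[OF N] derivation_dz derivation_dw
        dz_dw_const dz_dw_coords in auto)
qed

theorem theorem9:
  fixes N m :: nat and a :: "nat \<Rightarrow> nat \<Rightarrow> complex"
  assumes "N \<ge> 2"
    and "\<And>j. j \<in> {1..N - 1} \<Longrightarrow> q_coeffs N m j (a j)"
  shows "m_harmonic N m 1
    \<and> (\<forall>j\<in>{1..N - 1}. m_harmonic N m (q_poly N m j (a j)) \<and> m_harmonic N m (qbar_poly N m j (a j)))
    \<and> m_harmonic N m (q_last N m)"
proof -
  interpret zw: isotropic_coords N m rz rw dz dw using assms(1) by (rule isotropic_coords_complex)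
  interpret wz: isotropic_coords N m rw rz dw dz using assms(1) by (rule isotropic_coords_complex)
  have sigma2: "to_fract (sigma2 N) = rz ^ N + rw ^ N"
    by (simp add: sigma2_def to_fract_power)
  have pow: "(CM_op N m ^^ N) f = 0" if "CM_op N m f = 0" for f
    using assms(1) that by (cases N) (simp_all add: funpow_Suc_right CM_op_funpow_0 del: funpow.simps)
  have "m_harmonic N m 1"
    by (rule m_harmonicI) (use zw.harmonic_one pow in \<open>simp_all add: sigma2\<close>)
  moreover have "m_harmonic N m (q_last N m)"
  proof (rule m_harmonicI)
    have "to_fract (q_last N m) = (rz ^ N - rw ^ N) ^ (2 * m + 1)"
      by (simp only: q_last_def to_fract_power to_fract_diff)
    thus "CM_op N m (to_fract (q_last N m)) = 0"
      "(CM_op N m ^^ N) (to_fract (sigma2 N) * to_fract (q_last N m)) = 0"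
      unfolding sigma2 by (simp_all only: zw.harmonic_last pow)
  qed
  moreover have "m_harmonic N m (q_poly N m j (a j))" "m_harmonic N m (qbar_poly N m j (a j))"
    if "j \<in> {1..N - 1}" for j
  proof -
    have j: "0 < j" "j < N" using that assms(1) by auto
    note rec = q_coeffs_rec[OF assms(2)[OF that] j]
    \<comment> \<open>The multipliers in the recursion are real, so the conjugate coefficients
      satisfy it as well; they are fed to the interpretation with the variables exchanged.\<close>
    have rec_cnj: "cnj (a j (Suc t)) * of_nat (Suc t) * (of_nat j - of_nat (Suc t * N))
       + cnj (a j t) * of_nat (m - t) * of_nat ((m - t) * N + j) = 0" if "t < m" for t
      using arg_cong[OF rec[OF that], of cnj]
      by (simp only: complex_cnj_add complex_cnj_mult complex_cnj_diff complex_cnj_of_nat complex_cnj_zero)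
    have "to_fract (q_poly N m j (a j)) = (\<Sum>t\<le>m. rcst (a j t) * zw.mono_term j 0 t)"
      by (simp add: q_poly_def zw.mono_term_def to_fract_sum to_fract_power atLeast0AtMost mult_ac)
    thus "m_harmonic N m (q_poly N m j (a j))"
      by (intro m_harmonicI) (simp_all only: sigma2 zw.harmonic_q[OF j rec])
    have "to_fract (qbar_poly N m j (a j)) = (\<Sum>t\<le>m. rcst (cnj (a j t)) * wz.mono_term j 0 t)"
      by (simp add: qbar_poly_def wz.mono_term_def to_fract_sum to_fract_power atLeast0AtMost mult_ac)
    thus "m_harmonic N m (qbar_poly N m j (a j))"
      by (intro m_harmonicI)
        (simp_all only: sigma2 add.commute[of "rz ^ N"] wz.harmonic_q[OF j rec_cnj])
  qed
  ultimately show ?thesis by blast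
qed

end
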